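(* Let $\kappa\neq 0$ and let $(\mathbf u,P)$ be a smooth solution of the steady Navier–Stokes system $$-\Delta\mathbf u+(\mathbf u\cdot\nabla)\mathbf u+\nabla P=0,\qquad \nabla\cdot\mathbf u=0\qquad\text{in }\mathbb R^3,$$ such that $\mathbf u$ is bounded on $\mathbb R^3$ and $\mathbf u$ is helically symmetric with pitch $\kappa$. Then $\mathbf u$ is a constant vector of the form $\mathbf u\equiv(0,0,C)$ for some $C\in\mathbb R$.
   Context: For $\rho\in\mathbb R$ let $R_\rho=\begin{pmatrix}\cos\rho&\sin\rho&0\\-\sin\rho&\cos\rho&0\\0&0&1\end{pmatrix}$ and $S_\rho(\mathbf x)=R_\rho\mathbf x+(0,0,\kappa\rho)^T$. A vector field $\mathbf u$ on $\mathbb R^3$ is helically symmetric (with pitch $\kappa$) if $\mathbf u(S_\rho(\mathbf x))=R_\rho\mathbf u(\mathbf x)$ for all $\rho\in\mathbb R$ and all $\mathbf x\in\mathbb R^3$; a scalar function $h$ is helically symmetric if $h(S_\rho(\mathbf x))=h(\mathbf x)$ for all $\rho,\mathbf x$. *)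

theory Defs
  imports "HOL-Analysis.Analysis"
begin

fun Ck :: "nat \<Rightarrow> (real^3 \<Rightarrow> 'b::real_normed_vector) \<Rightarrow> bool" where
  "Ck 0 f = continuous_on UNIV f"
| "Ck (Suc k) f = (\<exists>f'. (\<forall>x. (f has_derivative f' x) (at x)) \<and> (\<forall>v. Ck k (\<lambda>x. f' x v)))"

definition smooth :: "(real^3 \<Rightarrow> 'b::real_normed_vector) \<Rightarrow> bool" where
  "smooth f \<longleftrightarrow> (\<forall>k. Ck k f)"

definition pd :: "3 \<Rightarrow> (real^3 \<Rightarrow> real) \<Rightarrow> real^3 \<Rightarrow> real" where
  "pd i f x = frechet_derivative f (at x) (axis i 1)"

definition laplacian :: "(real^3 \<Rightarrow> real) \<Rightarrow> real^3 \<Rightarrow> real" where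
  "laplacian f x = (\<Sum>i\<in>UNIV. pd i (pd i f) x)"

definition divergence :: "(real^3 \<Rightarrow> real^3) \<Rightarrow> real^3 \<Rightarrow> real" where
  "divergence u x = (\<Sum>i\<in>UNIV. pd i (\<lambda>y. u y $ i) x)"

definition steady_NS :: "(real^3 \<Rightarrow> real^3) \<Rightarrow> (real^3 \<Rightarrow> real) \<Rightarrow> bool" where
  "steady_NS u P \<longleftrightarrow>
     (\<forall>x j. - laplacian (\<lambda>y. u y $ j) x
             + (\<Sum>i\<in>UNIV. u x $ i * pd i (\<lambda>y. u y $ j) x)
             + pd j P x = 0)
   \<and> (\<forall>x. divergence u x = 0)"

definition rotR :: "real \<Rightarrow> real^3 \<Rightarrow> real^3" where
  "rotR \<rho> x = vector [cos \<rho> * x$1 + sin \<rho> * x$2, - sin \<rho> * x$1 + cos \<rho> * x$2, x$3]"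

definition helS :: "real \<Rightarrow> real \<Rightarrow> real^3 \<Rightarrow> real^3" where
  "helS \<kappa> \<rho> x = rotR \<rho> x + vector [0, 0, \<kappa> * \<rho>]"

definition helically_symmetric_field :: "real \<Rightarrow> (real^3 \<Rightarrow> real^3) \<Rightarrow> bool" where
  "helically_symmetric_field \<kappa> u \<longleftrightarrow> (\<forall>\<rho> x. u (helS \<kappa> \<rho> x) = rotR \<rho> (u x))"

end

(* Helical symmetry makes u periodic in the vertical direction, so integrate over the slab R^2 x [0, L],
   L = 2 pi |kappa|, against radial cutoffs. Testing the equation with the divergence of
   (cutoff^4 * vorticity) removes the pressure and shows that the Dirichlet energy E(R) in the cylinder of
   radius R, and the L^2 norm squared of the Laplacian, are O(R^2). In the energy identity the head pressure is
   multiplied by the radial flux, whose vertical means vanish by helical symmetry and incompressibility;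
   the one-dimensional Poincare inequality in the vertical direction then gives
   E(R)^2 <= C (E(2R) - E(R/2)). A nonzero E would have to grow faster than any power of R, so E = 0,
   u is constant, and helical symmetry leaves only the vertical component. *)

theory Submission
  imports Defs
begin

section \<open>Partial derivatives\<close>

text \<open>The pressure itself is never bounded; it enters the estimates only through its gradient,
  which the equation expresses by the velocity. Hence the role of the Laplacian: it controls the
  vertical derivative of the head pressure, and the Poincare inequality asks for nothing more.
  Periodicity of the pressure is a separate task, since a periodic gradient still allows a linear
  drift in height; the vertical momentum balance on large cylinders excludes the drift. The cutoff
  gradient is \<open>cutoff_slope\<close>, of order R^-2, times the horizontal position. With a free
  weight \<open>e\<close>, the head contributes R^-2 * e * O(R^2) and the flux R^-2 * R^2 * (shell
  energy) / e. All powers of R cancel, and \<open>e\<close> proportional to the energy gives the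
  quadratic inequality. The square on its left side is essential: a linear inequality of this kind
  would only force growth like some power of R depending on the constant, which need not contradict
  O(R^2).\<close>

definition C1 :: "(real^3 \<Rightarrow> real) \<Rightarrow> bool" where
  "C1 f \<longleftrightarrow> (\<forall>x. f differentiable at x) \<and> (\<forall>i. continuous_on UNIV (pd i f))"

lemma C1_if_Ck:
  assumes "Ck (Suc 0) f"
  shows "C1 f"
proof -
  from assms obtain f' where f': "\<And>x. (f has_derivative f' x) (at x)"
    and c: "\<And>v. continuous_on UNIV (\<lambda>x. f' x v)"
    by auto
  have "pd i f = (\<lambda>x. f' x (axis i 1))" for i
    using frechet_derivative_at[OF f'] by (auto simp: pd_def fun_eq_iff)
  with c f' show ?thesis
    unfolding C1_def by (auto intro: differentiableI)
qed

lemma smooth_imp_C1: "smooth f \<Longrightarrow> C1 f"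
  unfolding smooth_def by (rule C1_if_Ck) blast

lemma smooth_pd:
  assumes "smooth f"
  shows "smooth (pd i f)"
  unfolding smooth_def
proof
  fix k
  have "Ck (Suc k) f" using assms by (auto simp: smooth_def simp del: Ck.simps)
  then obtain f' where f': "\<And>x. (f has_derivative f' x) (at x)" and k: "\<And>v. Ck k (\<lambda>x. f' x v)"
    by auto
  have "pd i f = (\<lambda>x. f' x (axis i 1))"
    using frechet_derivative_at[OF f'] by (auto simp: pd_def fun_eq_iff)
  with k show "Ck k (pd i f)" by simp
qed

lemma Ck_component: "Ck k u \<Longrightarrow> Ck k (\<lambda>x. (u x :: real^'n) $ j)"
proof (induction k arbitrary: u)
  case 0
  then show ?case by (auto intro!: continuous_intros)
next
  case (Suc k)
  then obtain u' where u': "\<And>x. (u has_derivative u' x) (at x)" and k: "\<And>v. Ck k (\<lambda>x. u' x v)"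
    by auto
  have "((\<lambda>x. u x $ j) has_derivative (\<lambda>v. u' x v $ j)) (at x)" for x
    using bounded_linear.has_derivative[OF bounded_linear_vec_nth u'] .
  moreover have "Ck k (\<lambda>x. u' x v $ j)" for v using Suc.IH[OF k] .
  ultimately show ?case unfolding Ck.simps by (intro exI[of _ "\<lambda>x v. u' x v $ j"]) simp
qed

lemma smooth_component: "smooth u \<Longrightarrow> smooth (\<lambda>x. (u x :: real^'n) $ j)"
  by (simp add: smooth_def Ck_component)

lemma C1_has_derivative_frechet: "C1 f \<Longrightarrow> (f has_derivative frechet_derivative f (at x)) (at x)"
  by (simp add: C1_def frechet_derivative_works)

lemma frechet_eq_pd:
  assumes "f differentiable at x"
  shows "frechet_derivative f (at x) h = (\<Sum>i\<in>UNIV. h $ i * pd i f x)"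
proof -
  have l: "linear (frechet_derivative f (at x))" using linear_frechet_derivative[OF assms] .
  have "frechet_derivative f (at x) h = frechet_derivative f (at x) (\<Sum>i\<in>UNIV. h $ i *\<^sub>R axis i 1)"
    using basis_expansion[of h] by (simp add: scalar_mult_eq_scaleR)
  then show ?thesis
    by (simp add: linear_sum[OF l] linear_cmul[OF l] pd_def)
qed

lemma C1_has_derivative:
  assumes "C1 f"
  shows "(f has_derivative (\<lambda>h. h$1 * pd 1 f x + h$2 * pd 2 f x + h$3 * pd 3 f x)) (at x)"
proof -
  have "f differentiable at x" using assms by (simp add: C1_def)
  then have "frechet_derivative f (at x) = (\<lambda>h. h$1 * pd 1 f x + h$2 * pd 2 f x + h$3 * pd 3 f x)"
    by (auto simp: fun_eq_iff frechet_eq_pd sum_3)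
  then show ?thesis using C1_has_derivative_frechet[OF assms, of x] by simp
qed

lemma pdI: "(f has_derivative f') (at x) \<Longrightarrow> pd i f x = f' (axis i 1)"
  unfolding pd_def by (metis frechet_derivative_at)

lemma C1_I:
  assumes "\<And>x. (f has_derivative f' x) (at x)" "\<And>i. continuous_on UNIV (\<lambda>x. f' x (axis i 1))"
  shows "C1 f"
proof -
  have "pd i f = (\<lambda>x. f' x (axis i 1))" for i using pdI[OF assms(1)] by (auto simp: fun_eq_iff)
  with assms show ?thesis unfolding C1_def by (auto intro: differentiableI)
qed

lemma C1_cont: "C1 f \<Longrightarrow> continuous_on S f"
  unfolding C1_def
  by (meson continuous_on_subset differentiable_at_withinI differentiable_imp_continuous_on
      differentiable_on_def subset_UNIV)

lemma C1_pd_cont: "C1 f \<Longrightarrow> continuous_on S (pd i f)"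
  unfolding C1_def by (meson continuous_on_subset subset_UNIV)

section \<open>Calculus rules for continuously differentiable functions\<close>

lemma
  assumes f: "C1 f" and g: "C1 g"
  shows C1_add: "C1 (\<lambda>x. f x + g x)"
    and C1_diff: "C1 (\<lambda>x. f x - g x)"
    and C1_mult: "C1 (\<lambda>x. f x * g x)"
    and pd_add: "pd i (\<lambda>x. f x + g x) x = pd i f x + pd i g x"
    and pd_diff: "pd i (\<lambda>x. f x - g x) x = pd i f x - pd i g x"
    and pd_mult: "pd i (\<lambda>x. f x * g x) x = pd i f x * g x + f x * pd i g x"
proof -
  note d = C1_has_derivative_frechet[OF f] C1_has_derivative_frechet[OF g]
  have e: "frechet_derivative f (at x) (axis i 1) = pd i f x"
    "frechet_derivative g (at x) (axis i 1) = pd i g x" for i x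
    by (simp_all add: pd_def)
  note c = C1_pd_cont[OF f] C1_pd_cont[OF g] C1_cont[OF f] C1_cont[OF g]
  have a: "((\<lambda>x. f x + g x) has_derivative
      (\<lambda>h. frechet_derivative f (at x) h + frechet_derivative g (at x) h)) (at x)" for x
    by (intro has_derivative_add d)
  have b: "((\<lambda>x. f x - g x) has_derivative
      (\<lambda>h. frechet_derivative f (at x) h - frechet_derivative g (at x) h)) (at x)" for x
    by (intro has_derivative_diff d)
  have m: "((\<lambda>x. f x * g x) has_derivative
      (\<lambda>h. f x * frechet_derivative g (at x) h + frechet_derivative f (at x) h * g x)) (at x)" for x
    by (intro has_derivative_mult d)
  show "C1 (\<lambda>x. f x + g x)" by (rule C1_I[OF a]) (auto simp: e intro!: continuous_intros c)
  show "C1 (\<lambda>x. f x - g x)" by (rule C1_I[OF b]) (auto simp: e intro!: continuous_intros c)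
  show "C1 (\<lambda>x. f x * g x)" by (rule C1_I[OF m]) (auto simp: e intro!: continuous_intros c)
  show "pd i (\<lambda>x. f x + g x) x = pd i f x + pd i g x" using pdI[OF a] by (simp add: e)
  show "pd i (\<lambda>x. f x - g x) x = pd i f x - pd i g x" using pdI[OF b] by (simp add: e)
  show "pd i (\<lambda>x. f x * g x) x = pd i f x * g x + f x * pd i g x" using pdI[OF m] by (simp add: e)
qed

lemma C1_const: "C1 (\<lambda>x. c)" and pd_const: "pd i (\<lambda>x. c) x = 0"
proof -
  have d: "((\<lambda>x. c) has_derivative (\<lambda>_. 0)) (at x)" for x :: "real^3" by simp
  show "C1 (\<lambda>x. c)" by (rule C1_I[OF d]) auto
  show "pd i (\<lambda>x. c) x = 0" using pdI[OF d] .
qed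

lemma C1_coord: "C1 (\<lambda>x. x $ j)" and pd_coord: "pd i (\<lambda>x. x $ j) x = (if i = j then 1 else 0)"
proof -
  have d: "((\<lambda>x. x $ j) has_derivative (\<lambda>h. h $ j)) (at x)" for x :: "real^3"
    by (intro bounded_linear_imp_has_derivative bounded_linear_vec_nth)
  show "C1 (\<lambda>x. x $ j)" by (rule C1_I[OF d]) auto
  show "pd i (\<lambda>x. x $ j) x = (if i = j then 1 else 0)" using pdI[OF d, of i x] by (simp add: axis_def)
qed

lemma C1_sum:
  assumes "finite A" "\<And>j. j \<in> A \<Longrightarrow> C1 (f j)"
  shows "C1 (\<lambda>x. \<Sum>j\<in>A. f j x)" "pd i (\<lambda>x. \<Sum>j\<in>A. f j x) x = (\<Sum>j\<in>A. pd i (f j) x)"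
proof -
  have "C1 (\<lambda>x. \<Sum>j\<in>A. f j x) \<and> pd i (\<lambda>x. \<Sum>j\<in>A. f j x) x = (\<Sum>j\<in>A. pd i (f j) x)"
    using assms by (induction A rule: finite_induct) (auto simp: C1_const pd_const C1_add pd_add)
  then show "C1 (\<lambda>x. \<Sum>j\<in>A. f j x)" "pd i (\<lambda>x. \<Sum>j\<in>A. f j x) x = (\<Sum>j\<in>A. pd i (f j) x)"
    by auto
qed

lemmas C1_intros = C1_add C1_diff C1_mult C1_const C1_coord C1_sum(1)

lemma C1_compose:
  assumes g: "C1 g" and f: "\<And>t. (f has_real_derivative f' t) (at t)" and f': "continuous_on UNIV f'"
  shows "C1 (\<lambda>x. f (g x))" "pd i (\<lambda>x. f (g x)) x = f' (g x) * pd i g x"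
proof -
  have d: "((\<lambda>x. f (g x)) has_derivative (\<lambda>h. f' (g x) * frechet_derivative g (at x) h)) (at x)" for x
    using has_derivative_compose[OF C1_has_derivative_frechet[OF g]
        f[of "g x", unfolded has_field_derivative_def]]
    by simp
  have "continuous_on UNIV (\<lambda>x. f' (g x))"
    by (rule continuous_on_compose2[OF f' C1_cont[OF g]]) auto
  then show "C1 (\<lambda>x. f (g x))"
    by (intro C1_I[OF d]) (auto simp: pd_def[symmetric] intro!: continuous_intros C1_pd_cont[OF g])
  show "pd i (\<lambda>x. f (g x)) x = f' (g x) * pd i g x" using pdI[OF d] by (simp add: pd_def)
qed

text \<open>The chain rule in coordinates; it serves coordinate lines, rays leaving the vertical
  axis, and helical orbits.\<close>

lemma C1_curve:
  assumes f: "C1 f" and c: "\<And>i. ((\<lambda>t. c t $ i) has_real_derivative c' i) (at t within S)"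
  shows "((\<lambda>t. f (c t)) has_real_derivative
    (c' 1 * pd 1 f (c t) + c' 2 * pd 2 f (c t) + c' 3 * pd 3 f (c t))) (at t within S)"
proof -
  have "(c has_derivative (\<lambda>h. \<chi> i. h * c' i)) (at t within S)"
  proof (subst has_derivative_componentwise_within, intro ballI)
    fix b :: "real^3" assume "b \<in> Basis"
    then obtain i where b: "b = axis i 1" by (auto simp: Basis_vec_def)
    show "((\<lambda>x. c x \<bullet> b) has_derivative (\<lambda>x. (\<chi> i. x * c' i) \<bullet> b)) (at t within S)"
      using c[of i] by (simp add: b inner_axis has_field_derivative_def mult.commute[of _ "c' i"])
  qed
  from has_derivative_compose[OF this C1_has_derivative[OF f]]
  show ?thesis
    unfolding has_field_derivative_def
    by (rule has_derivative_eq_rhs) (simp add: fun_eq_iff algebra_simps)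
qed

section \<open>Symmetry of mixed second derivatives\<close>

lemma mixed_difference:
  assumes f: "C1 f" and g: "C1 (pd i f)" and h: "0 < h"
  shows "\<exists>s t. 0 < s \<and> s < h \<and> 0 < t \<and> t < h \<and>
    f (x + h *\<^sub>R axis i 1 + h *\<^sub>R axis j 1) - f (x + h *\<^sub>R axis i 1) - f (x + h *\<^sub>R axis j 1) + f x
      = h * h * pd j (pd i f) (x + s *\<^sub>R axis i 1 + t *\<^sub>R axis j 1)"
proof -
  have d: "((\<lambda>s. F (y + s *\<^sub>R axis k 1)) has_real_derivative pd k F (y + s *\<^sub>R axis k 1)) (at s)"
    if "C1 F" for F :: "real^3 \<Rightarrow> real" and y k s
  proof -
    have "((\<lambda>s. (y + s *\<^sub>R axis k 1) $ l) has_real_derivative (axis k 1 :: real^3) $ l) (at s)" for l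
      by (auto intro!: derivative_eq_intros)
    from C1_curve[OF that, of "\<lambda>s. y + s *\<^sub>R axis k 1", OF this] show ?thesis
      using exhaust_3[of k] by (auto simp: axis_def)
  qed
  \<comment> \<open>\<open>G\<close> is the increment in direction \<open>j\<close> as a function of
    the displacement in direction \<open>i\<close>. The mean value theorem is applied to
    \<open>G\<close>, then to \<open>pd i f\<close> in direction \<open>j\<close>.\<close>
  define G where "G = (\<lambda>s. f (x + h *\<^sub>R axis j 1 + s *\<^sub>R axis i 1) - f (x + s *\<^sub>R axis i 1))"
  have "(G has_real_derivative (pd i f (x + h *\<^sub>R axis j 1 + s *\<^sub>R axis i 1) - pd i f (x + s *\<^sub>R axis i 1))) (at s)" for s
    unfolding G_def by (intro derivative_intros d f)
  from MVT2[OF h this] obtain s where s: "0 < s" "s < h"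
    "G h - G 0 = h * (pd i f (x + h *\<^sub>R axis j 1 + s *\<^sub>R axis i 1) - pd i f (x + s *\<^sub>R axis i 1))"
    by auto
  have "((\<lambda>t. pd i f (x + s *\<^sub>R axis i 1 + t *\<^sub>R axis j 1)) has_real_derivative
     pd j (pd i f) (x + s *\<^sub>R axis i 1 + t *\<^sub>R axis j 1)) (at t)" for t
    by (intro d g)
  from MVT2[OF h this] obtain t where t: "0 < t" "t < h"
    "pd i f (x + s *\<^sub>R axis i 1 + h *\<^sub>R axis j 1) - pd i f (x + s *\<^sub>R axis i 1)
      = h * pd j (pd i f) (x + s *\<^sub>R axis i 1 + t *\<^sub>R axis j 1)"
    by auto
  show ?thesis
    using s t by (intro exI[of _ s] exI[of _ t]) (auto simp: G_def add_ac)
qed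

text \<open>The second difference in \<open>mixed_difference\<close> is symmetric in
  \<open>i\<close> and \<open>j\<close>, so the two mixed derivatives take a common value at points
  arbitrarily close to \<open>x\<close>. If they differed at \<open>x\<close>, continuity with
  tolerance half the gap would be contradicted.\<close>

lemma pd_commute:
  assumes f: "C1 f" and pi: "C1 (pd i f)" and pj: "C1 (pd j f)"
  shows "pd i (pd j f) x = pd j (pd i f) x"
proof (rule ccontr)
  assume ne: "pd i (pd j f) x \<noteq> pd j (pd i f) x"
  define e where "e = \<bar>pd i (pd j f) x - pd j (pd i f) x\<bar> / 2"
  have e: "e > 0" using ne by (simp add: e_def)
  have "isCont (pd i (pd j f)) x" "isCont (pd j (pd i f)) x"
    using C1_pd_cont[OF pi, of UNIV] C1_pd_cont[OF pj, of UNIV]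
    by (auto simp: continuous_on_eq_continuous_at)
  then obtain d1 d2 where d: "d1 > 0" "d2 > 0"
    "\<And>y. dist y x < d1 \<Longrightarrow> dist (pd i (pd j f) y) (pd i (pd j f) x) < e"
    "\<And>y. dist y x < d2 \<Longrightarrow> dist (pd j (pd i f) y) (pd j (pd i f) x) < e"
    using e unfolding continuous_at_eps_delta by metis
  define h where "h = min d1 d2 / 2"
  have h: "h > 0" using d by (simp add: h_def)
  have nb: "dist (x + s *\<^sub>R axis k 1 + t *\<^sub>R axis l 1) x < 2 * h"
    if "0 < s" "s < h" "0 < t" "t < h" for s t and k l :: 3
  proof -
    have "norm (s *\<^sub>R axis k 1 + t *\<^sub>R axis l 1 :: real^3) \<le> s + t"
      using norm_triangle_ineq[of "s *\<^sub>R axis k 1 :: real^3" "t *\<^sub>R axis l 1"] that by (simp add: norm_axis_1)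
    then show ?thesis using that by (simp add: dist_norm add.assoc)
  qed
  obtain s t where st: "0 < s" "s < h" "0 < t" "t < h" 
    "f (x + h *\<^sub>R axis i 1 + h *\<^sub>R axis j 1) - f (x + h *\<^sub>R axis i 1) - f (x + h *\<^sub>R axis j 1) + f x
      = h * h * pd j (pd i f) (x + s *\<^sub>R axis i 1 + t *\<^sub>R axis j 1)"
    using mixed_difference[OF f pi h] by metis
  obtain s' t' where st': "0 < s'" "s' < h" "0 < t'" "t' < h" 
    "f (x + h *\<^sub>R axis j 1 + h *\<^sub>R axis i 1) - f (x + h *\<^sub>R axis j 1) - f (x + h *\<^sub>R axis i 1) + f x
      = h * h * pd i (pd j f) (x + s' *\<^sub>R axis j 1 + t' *\<^sub>R axis i 1)"
    using mixed_difference[OF f pj h] by metis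
  have "h * h * pd j (pd i f) (x + s *\<^sub>R axis i 1 + t *\<^sub>R axis j 1)
      = h * h * pd i (pd j f) (x + s' *\<^sub>R axis j 1 + t' *\<^sub>R axis i 1)"
    using st(5) st'(5) by (simp only: add.assoc add.commute[of "h *\<^sub>R axis j 1"])
  then have eq: "pd j (pd i f) (x + s *\<^sub>R axis i 1 + t *\<^sub>R axis j 1)
      = pd i (pd j f) (x + s' *\<^sub>R axis j 1 + t' *\<^sub>R axis i 1)"
    using h by simp
  have "dist (pd i (pd j f) (x + s' *\<^sub>R axis j 1 + t' *\<^sub>R axis i 1)) (pd i (pd j f) x) < e"
    using nb[OF st'(1-4)] by (intro d) (simp add: h_def)
  moreover have "dist (pd j (pd i f) (x + s *\<^sub>R axis i 1 + t *\<^sub>R axis j 1)) (pd j (pd i f) x) < e"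
    using nb[OF st(1-4)] by (intro d) (simp add: h_def)
  ultimately show False
    using eq dist_triangle3[of "pd i (pd j f) x" "pd j (pd i f) x" "pd j (pd i f) (x + s *\<^sub>R axis i 1 + t *\<^sub>R axis j 1)"]
    by (simp add: e_def dist_real_def[of "pd i (pd j f) x" "pd j (pd i f) x"])
qed

section \<open>Integration over a slab\<close>

text \<open>Integration runs over the product type, where boxes and Fubini are available, while
  differentiation stays on \<open>real^3\<close>; \<open>pt\<close> is the bridge.\<close>

definition pt :: "real \<times> real \<times> real \<Rightarrow> real^3" where
  "pt p = vector [fst p, fst (snd p), snd (snd p)]"

lemma pt_nth [simp]: "pt (x, y, z) $ 1 = x" "pt (x, y, z) $ 2 = y" "pt (x, y, z) $ 3 = z"
  by (simp_all add: pt_def)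

lemma pt_nth': "pt p $ 1 = fst p" "pt p $ 2 = fst (snd p)" "pt p $ 3 = snd (snd p)"
  by (simp_all add: pt_def)

lemma pt_coords: "pt (x $ 1, x $ 2, x $ 3) = x"
  by (simp add: vec_eq_iff forall_3)

lemma continuous_on_pt [continuous_intros]:
  assumes "continuous_on S f"
  shows "continuous_on S (\<lambda>p. pt (f p))"
proof -
  have "continuous_on S (\<lambda>p. pt (f p) $ i)" for i
    using exhaust_3[of i] by (elim disjE; simp add: pt_nth'; intro continuous_intros assms)
  then have "continuous_on S (\<lambda>p. \<chi> i. pt (f p) $ i)" by (rule continuous_on_vec_lambda)
  then show ?thesis by simp
qed

lemma continuous_on_comp_pt:
  assumes "continuous_on UNIV f" "continuous_on S g"
  shows "continuous_on S (\<lambda>p. f (pt (g p)))"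
  by (rule continuous_on_compose2[OF assms(1) continuous_on_pt[OF assms(2)]]) auto

text \<open>The square base keeps the domain a box. Localization to cylinders comes from radial
  cutoffs in the integrand, so \<open>K\<close> only has to be large enough to contain their
  support.\<close>

definition slab_int :: "real \<Rightarrow> real \<Rightarrow> (real^3 \<Rightarrow> real) \<Rightarrow> real" where
  "slab_int L K f = integral (cbox (-K, -K, 0) (K, K, L)) (\<lambda>p. f (pt p))"

lemma slab_integrable:
  fixes f :: "real^3 \<Rightarrow> real"
  shows "continuous_on UNIV f \<Longrightarrow> (\<lambda>p. f (pt p)) integrable_on cbox a b"
  by (rule integrable_continuous[OF continuous_on_comp_pt[OF _ continuous_on_id]])

lemma
  assumes "continuous_on UNIV f" "continuous_on UNIV g"
  shows slab_add: "slab_int L K (\<lambda>x. f x + g x) = slab_int L K f + slab_int L K g"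
    and slab_diff: "slab_int L K (\<lambda>x. f x - g x) = slab_int L K f - slab_int L K g"
  using assms unfolding slab_int_def
  by (simp_all add: integral_add integral_diff slab_integrable)

lemma slab_cmult: "slab_int L K (\<lambda>x. c * f x) = c * slab_int L K f"
  unfolding slab_int_def by simp

lemma slab_mono:
  assumes "continuous_on UNIV f" "continuous_on UNIV g" "\<And>x. f x \<le> g x"
  shows "slab_int L K f \<le> slab_int L K g"
  using assms unfolding slab_int_def by (intro integral_le slab_integrable) auto

lemma slab_nonneg:
  assumes "continuous_on UNIV f" "\<And>x. 0 \<le> f x"
  shows "0 \<le> slab_int L K f"
  using assms unfolding slab_int_def by (intro integral_nonneg slab_integrable) auto

lemma slab_sum:
  assumes "finite A" "\<And>j. j \<in> A \<Longrightarrow> continuous_on UNIV (f j)"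
  shows "slab_int L K (\<lambda>x. \<Sum>j\<in>A. f j x) = (\<Sum>j\<in>A. slab_int L K (f j))"
  using assms unfolding slab_int_def by (subst integral_sum) (auto intro: slab_integrable)

lemma slab_const:
  assumes "0 \<le> L" "0 \<le> K"
  shows "slab_int L K (\<lambda>x. c) = 4 * K\<^sup>2 * L * c"
  using assms unfolding slab_int_def 
  by (simp add: content_Pair power2_eq_square)

lemma slab_enlarge:
  assumes f: "continuous_on UNIV f" and K: "K \<le> K'"
    and 0: "\<And>x. \<bar>x $ 1\<bar> > K \<or> \<bar>x $ 2\<bar> > K \<Longrightarrow> f x = 0"
  shows "slab_int L K' f = slab_int L K f"
proof -
  let ?A = "cbox (-K, -K, 0) (K, K, L)" and ?B = "cbox (-K', -K', 0) (K', K', L)"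
  have sub: "?A \<subseteq> ?B" using K by (auto simp: cbox_Pair_eq)
  have "integral ?B (\<lambda>p. f (pt p)) = integral ?B (\<lambda>p. if p \<in> ?A then f (pt p) else 0)"
    by (rule integral_cong) (auto simp: cbox_Pair_eq intro!: 0)
  also have "\<dots> = integral ?A (\<lambda>p. f (pt p))"
    using sub by (simp add: integral_restrict_Int Int_absorb2 Int_absorb1)
  finally show ?thesis by (simp add: slab_int_def)
qed

lemma slab_subset:
  assumes f: "continuous_on UNIV f" and K: "K \<le> K'" and 0: "\<And>x. 0 \<le> f x"
  shows "slab_int L K f \<le> slab_int L K' f"
  unfolding slab_int_def using K 0
  by (intro integral_subset_le slab_integrable f) (auto simp: cbox_Pair_eq)

lemma slab_iterated:
  assumes "continuous_on UNIV f"
  shows "slab_int L K f = integral {-K..K} (\<lambda>x. integral (cbox (-K, 0) (K, L)) (\<lambda>q. f (pt (x, q))))"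
    "integral (cbox (-K, 0) (K, L)) (\<lambda>q. f (pt (x, q)))
      = integral {-K..K} (\<lambda>y. integral {0..L} (\<lambda>z. f (pt (x, y, z))))"
proof -
  show "slab_int L K f = integral {-K..K} (\<lambda>x. integral (cbox (-K, 0) (K, L)) (\<lambda>q. f (pt (x, q))))"
    unfolding slab_int_def
    by (subst integral_prod_continuous)
      (auto simp: cbox_interval intro!: continuous_on_comp_pt[OF assms] continuous_intros)
  show "integral (cbox (-K, 0) (K, L)) (\<lambda>q. f (pt (x, q)))
      = integral {-K..K} (\<lambda>y. integral {0..L} (\<lambda>z. f (pt (x, y, z))))"
    by (subst integral_prod_continuous)
      (auto simp: cbox_interval intro!: continuous_on_comp_pt[OF assms] continuous_intros)
qed

text \<open>Transfers to the slab an inequality that holds only after integration along each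
  vertical line, not pointwise.\<close>

lemma slab_vertical_nonneg:
  assumes f: "continuous_on UNIV f" and v: "\<And>x y. 0 \<le> integral {0..L} (\<lambda>z. f (pt (x, y, z)))"
  shows "0 \<le> slab_int L K f"
proof -
  have c: "continuous_on S (\<lambda>x. integral (cbox (-K, 0) (K, L)) (\<lambda>q. f (pt (x, q))))" for S
    by (intro integral_continuous_on_param)
      (auto simp: split_def intro!: continuous_on_comp_pt[OF f] continuous_intros)
  have c': "continuous_on S (\<lambda>y. integral (cbox 0 L) (\<lambda>z. f (pt (x, y, z))))" for S x
    by (intro integral_continuous_on_param)
      (auto simp: split_def intro!: continuous_on_comp_pt[OF f] continuous_intros)
  show ?thesis
    unfolding slab_iterated[OF f]
  proof (rule integral_nonneg)
    show "(\<lambda>x. integral {-K..K} (\<lambda>y. integral {0..L} (\<lambda>z. f (pt (x, y, z))))) integrable_on {-K..K}"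
      using c by (auto simp: slab_iterated(2)[OF f, symmetric] intro!: integrable_continuous_real)
    show "0 \<le> integral {-K..K} (\<lambda>y. integral {0..L} (\<lambda>z. f (pt (x, y, z))))" for x
    proof (rule integral_nonneg)
      show "(\<lambda>y. integral {0..L} (\<lambda>z. f (pt (x, y, z)))) integrable_on {-K..K}"
        using c' by (auto simp: cbox_interval intro!: integrable_continuous_real)
    qed (rule v)
  qed
qed

section \<open>The divergence theorem in the slab\<close>

lemma C1_pt_derivs:
  assumes "C1 f"
  shows "((\<lambda>t. f (pt (t, y, z))) has_real_derivative pd 1 f (pt (t, y, z))) (at t within S)"
    "((\<lambda>t. f (pt (x, t, z))) has_real_derivative pd 2 f (pt (x, t, z))) (at t within S)"
    "((\<lambda>t. f (pt (x, y, t))) has_real_derivative pd 3 f (pt (x, y, t))) (at t within S)"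
proof -
  have "((\<lambda>t. pt (t, y, z) $ i) has_real_derivative (if i = 1 then 1 else 0)) (at t within S)" for i :: 3
    using exhaust_3[of i] by auto
  from C1_curve[OF assms, of "\<lambda>t. pt (t, y, z)", OF this]
  show "((\<lambda>t. f (pt (t, y, z))) has_real_derivative pd 1 f (pt (t, y, z))) (at t within S)" by simp
  have "((\<lambda>t. pt (x, t, z) $ i) has_real_derivative (if i = 2 then 1 else 0)) (at t within S)" for i :: 3
    using exhaust_3[of i] by auto
  from C1_curve[OF assms, of "\<lambda>t. pt (x, t, z)", OF this]
  show "((\<lambda>t. f (pt (x, t, z))) has_real_derivative pd 2 f (pt (x, t, z))) (at t within S)" by simp
  have "((\<lambda>t. pt (x, y, t) $ i) has_real_derivative (if i = 3 then 1 else 0)) (at t within S)" for i :: 3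
    using exhaust_3[of i] by auto
  from C1_curve[OF assms, of "\<lambda>t. pt (x, y, t)", OF this]
  show "((\<lambda>t. f (pt (x, y, t))) has_real_derivative pd 3 f (pt (x, y, t))) (at t within S)" by simp
qed

lemma integral_deriv_0:
  fixes F :: "real \<Rightarrow> real"
  assumes "\<And>t. (F has_real_derivative F' t) (at t within {a..b})" "F a = F b" "a \<le> b"
  shows "integral {a..b} F' = 0"
proof -
  have "(F' has_integral (F b - F a)) {a..b}"
    using assms by (intro fundamental_theorem_of_calculus) (auto simp: has_real_derivative_iff_has_vector_derivative)
  then show ?thesis using assms by (simp add: integral_unique)
qed

text \<open>Fubini puts the differentiated variable innermost. The boundary terms then vanish on the
  lateral faces and cancel between bottom and top.\<close>

lemma slab_pd:
  assumes f: "C1 f" and L: "0 \<le> L" and K: "0 \<le> K"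
    and 0: "\<And>x. \<bar>x $ 1\<bar> \<ge> K \<or> \<bar>x $ 2\<bar> \<ge> K \<Longrightarrow> f x = 0"
    and per: "\<And>x y. f (pt (x, y, L)) = f (pt (x, y, 0))"
  shows "slab_int L K (pd i f) = 0"
proof -
  note c = C1_pd_cont[OF f, of UNIV]
  have "slab_int L K (pd 1 f) = integral (cbox (-K, 0) (K, L)) (\<lambda>q. integral {-K..K} (\<lambda>x. pd 1 f (pt (x, q))))"
    unfolding slab_iterated(1)[OF c] 
    by (subst cbox_interval[symmetric], subst integral_swap_continuous)
       (auto simp: split_def intro!: continuous_on_comp_pt[OF c] continuous_intros)
  also have "(\<lambda>q. integral {-K..K} (\<lambda>x. pd 1 f (pt (x, q)))) = (\<lambda>q. 0)"
  proof
    fix q :: "real \<times> real"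
    show "integral {-K..K} (\<lambda>x. pd 1 f (pt (x, q))) = 0"
      using K by (cases q) (auto intro!: integral_deriv_0[OF C1_pt_derivs(1)[OF f]] simp: 0)
  qed
  finally have 1: "slab_int L K (pd 1 f) = 0" by simp
  have "integral {-K..K} (\<lambda>y. integral {0..L} (\<lambda>z. pd 2 f (pt (x, y, z)))) =
     integral {0..L} (\<lambda>z. integral {-K..K} (\<lambda>y. pd 2 f (pt (x, y, z))))" for x
    unfolding cbox_interval[symmetric]
    by (subst integral_swap_continuous)
       (auto simp: split_def intro!: continuous_on_comp_pt[OF c] continuous_intros)
  moreover have "integral {-K..K} (\<lambda>y. pd 2 f (pt (x, y, z))) = 0" for x z
    using K by (auto intro!: integral_deriv_0[OF C1_pt_derivs(2)[OF f]] simp: 0)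
  ultimately have 2: "slab_int L K (pd 2 f) = 0"
    unfolding slab_iterated[OF c] by simp
  have "integral {0..L} (\<lambda>z. pd 3 f (pt (x, y, z))) = 0" for x y
    using L by (auto intro!: integral_deriv_0[OF C1_pt_derivs(3)[OF f]] simp: per)
  then have 3: "slab_int L K (pd 3 f) = 0"
    unfolding slab_iterated[OF c] by simp
  show ?thesis using exhaust_3[of i] 1 2 3 by auto
qed

section \<open>One-dimensional Poincare inequalities\<close>

text \<open>Cauchy-Schwarz against the constant 1, read off from the nonnegative variance of
  \<open>\<bar>f\<bar>\<close> about its mean \<open>a / L\<close>.\<close>

lemma integral_square_le:
  fixes f :: "real \<Rightarrow> real"
  assumes "continuous_on {0..L} f" and "0 < L"
  shows "(integral {0..L} (\<lambda>t. \<bar>f t\<bar>))\<^sup>2 \<le> L * integral {0..L} (\<lambda>t. (f t)\<^sup>2)"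
proof -
  define a where "a = integral {0..L} (\<lambda>t. \<bar>f t\<bar>)"
  note i = integrable_continuous_real
  have "0 \<le> integral {0..L} (\<lambda>t. (\<bar>f t\<bar> - a / L)\<^sup>2)"
    by (intro integral_nonneg i) (auto intro!: continuous_intros assms)
  also have "(\<lambda>t. (\<bar>f t\<bar> - a / L)\<^sup>2) = (\<lambda>t. ((f t)\<^sup>2 - 2 * (a / L) * \<bar>f t\<bar>) + (a / L)\<^sup>2)"
    by (auto simp: power2_diff fun_eq_iff)
  also have "integral {0..L} \<dots> = integral {0..L} (\<lambda>t. (f t)\<^sup>2) - 2 * (a / L) * a + (a / L)\<^sup>2 * L"
    using \<open>0 < L\<close>
    by (subst integral_add integral_diff; (intro i continuous_intros assms)?)+ (simp add: a_def)
  also have "\<dots> = integral {0..L} (\<lambda>t. (f t)\<^sup>2) - a\<^sup>2 / L"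
    using \<open>0 < L\<close> by (simp add: power2_eq_square field_simps)
  finally show ?thesis using \<open>0 < L\<close> by (simp add: a_def field_simps)
qed

lemma integral_abs_le:
  fixes f :: "real \<Rightarrow> real"
  assumes "continuous_on {a..b} f" "continuous_on {a..b} g" "\<And>t. t \<in> {a..b} \<Longrightarrow> \<bar>f t\<bar> \<le> g t"
  shows "\<bar>integral {a..b} f\<bar> \<le> integral {a..b} g"
  using integral_norm_bound_integral[of f "{a..b}" g] assms
  by (auto intro: integrable_continuous_real)

lemma diff_le_integral_abs_deriv:
  fixes f :: "real \<Rightarrow> real"
  assumes d: "\<And>t. (f has_real_derivative f' t) (at t)" and c: "continuous_on UNIV f'"
    and s: "s \<in> {0..L}" and t: "t \<in> {0..L}"
  shows "\<bar>f t - f s\<bar> \<le> integral {0..L} (\<lambda>t. \<bar>f' t\<bar>)"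
proof -
  have c': "continuous_on S f'" for S using c continuous_on_subset by blast
  have *: "\<bar>f t - f s\<bar> \<le> integral {0..L} (\<lambda>t. \<bar>f' t\<bar>)" if "s \<le> t" "s \<in> {0..L}" "t \<in> {0..L}" for s t
  proof -
    have "(f' has_integral (f t - f s)) {s..t}"
      using that d by (intro fundamental_theorem_of_calculus)
        (auto simp: has_real_derivative_iff_has_vector_derivative[symmetric] intro: has_field_derivative_at_within)
    then have "f t - f s = integral {s..t} f'" by (simp add: integral_unique)
    then have "\<bar>f t - f s\<bar> \<le> integral {s..t} (\<lambda>t. \<bar>f' t\<bar>)"
      using integral_norm_bound_integral[of f' "{s..t}" "\<lambda>t. \<bar>f' t\<bar>"]
      by (auto intro!: integrable_continuous_real continuous_intros c')
    also have "\<dots> \<le> integral {0..L} (\<lambda>t. \<bar>f' t\<bar>)"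
      using that by (intro integral_subset_le integrable_continuous_real continuous_intros c') auto
    finally show ?thesis .
  qed
  show ?thesis
    using *[of s t] *[of t s] s t by (cases "s \<le> t") (auto simp: abs_minus_commute)
qed

text \<open>The zero mean of \<open>b\<close> allows replacing \<open>a\<close> by its oscillation
  \<open>a t - a 0\<close> and also bounds \<open>b\<close> by its own oscillation. Both
  oscillations are at most the L^1 norms of the derivatives, and Cauchy-Schwarz finishes. The weight
  \<open>e\<close> stays free because its best value depends on the energy.\<close>

lemma poincare_product:
  fixes a b :: "real \<Rightarrow> real"
  assumes L: "0 < L" and e: "0 < e"
    and a: "\<And>t. (a has_real_derivative a' t) (at t)" and a': "continuous_on UNIV a'"
    and b: "\<And>t. (b has_real_derivative b' t) (at t)" and b': "continuous_on UNIV b'"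
    and mean: "integral {0..L} b = 0"
  shows "\<bar>integral {0..L} (\<lambda>t. a t * b t)\<bar>
    \<le> L\<^sup>2 * (e * integral {0..L} (\<lambda>t. (a' t)\<^sup>2) + integral {0..L} (\<lambda>t. (b' t)\<^sup>2) / e)"
proof -
  note i = integrable_continuous_real
  define \<alpha> \<beta> where "\<alpha> = integral {0..L} (\<lambda>t. \<bar>a' t\<bar>)" and "\<beta> = integral {0..L} (\<lambda>t. \<bar>b' t\<bar>)"
  have ca: "continuous_on S a" "continuous_on S b" "continuous_on S a'" "continuous_on S b'" for S
    using continuous_on_subset[OF a'] continuous_on_subset[OF b'] 
      DERIV_continuous_on[of S a a', OF has_field_derivative_at_within[OF a]]
      DERIV_continuous_on[of S b b', OF has_field_derivative_at_within[OF b]]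
    by auto
  have nn: "0 \<le> \<alpha>" "0 \<le> \<beta>" unfolding \<alpha>_def \<beta>_def
    by (auto intro!: integral_nonneg i continuous_intros ca)
  have aa: "\<bar>a t - a 0\<bar> \<le> \<alpha>" if "t \<in> {0..L}" for t
    unfolding \<alpha>_def by (rule diff_le_integral_abs_deriv[OF a a']) (use that L in auto)
  have bb: "\<bar>b t\<bar> \<le> \<beta>" if t: "t \<in> {0..L}" for t
  proof -
    \<comment> \<open>Averaging \<open>b t - b s\<close> over \<open>s\<close> leaves
      \<open>b t\<close>, by the zero mean.\<close>
    have "L * b t = integral {0..L} (\<lambda>s. b t - b s)"
      using L by (subst integral_diff) (auto intro!: i continuous_intros ca simp: mean)
    also have "\<bar>\<dots>\<bar> \<le> integral {0..L} (\<lambda>s. \<beta>)"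
      using diff_le_integral_abs_deriv[OF b b' _ t]
      by (intro integral_abs_le) (auto intro!: i continuous_intros ca simp: \<beta>_def)
    finally have "L * \<bar>b t\<bar> \<le> L * \<beta>" using L by (simp add: abs_mult)
    then show ?thesis using L by simp
  qed
  have "integral {0..L} (\<lambda>t. a t * b t) = integral {0..L} (\<lambda>t. (a t - a 0) * b t) + a 0 * integral {0..L} b"
    by (subst integral_mult_right[symmetric], subst integral_add[symmetric])
      (auto intro!: i continuous_intros ca simp: algebra_simps)
  also have "\<dots> = integral {0..L} (\<lambda>t. (a t - a 0) * b t)" by (simp add: mean)
  also have "\<bar>\<dots>\<bar> \<le> integral {0..L} (\<lambda>t. \<alpha> * \<beta>)"
    using aa bb nn
    by (intro integral_abs_le) (auto intro!: i continuous_intros ca mult_mono simp: abs_mult)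
  also have "\<dots> = L * (\<alpha> * \<beta>)" using L by simp
  also have "\<alpha> * \<beta> \<le> e * \<alpha>\<^sup>2 + \<beta>\<^sup>2 / e"
  proof -
    have "0 \<le> (e * \<alpha> - \<beta>)\<^sup>2" by simp
    then have "2 * (e * \<alpha> * \<beta>) \<le> e * (e * \<alpha>\<^sup>2) + \<beta>\<^sup>2" by (simp add: power2_eq_square algebra_simps)
    moreover have "0 \<le> e * \<alpha> * \<beta>" using e nn by simp
    ultimately have "e * (\<alpha> * \<beta>) \<le> e * (e * \<alpha>\<^sup>2) + \<beta>\<^sup>2" by linarith
    then show ?thesis using e by (simp add: field_simps)
  qed
  also have "e * \<alpha>\<^sup>2 + \<beta>\<^sup>2 / e \<le> e * (L * integral {0..L} (\<lambda>t. (a' t)\<^sup>2)) + (L * integral {0..L} (\<lambda>t. (b' t)\<^sup>2)) / e"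
    unfolding \<alpha>_def \<beta>_def using e L ca
    by (intro add_mono mult_left_mono divide_right_mono integral_square_le) auto
  finally show ?thesis using L
    by (simp add: power2_eq_square algebra_simps mult_left_mono)
qed

section \<open>Cutoff functions\<close>

text \<open>The square of the positive part is continuously differentiable across 0. This is enough
  for the cutoffs, which are differentiated only once.\<close>

definition sq_pos :: "real \<Rightarrow> real" where
  "sq_pos t = (max 0 t)\<^sup>2"

lemma sq_pos_deriv: "(sq_pos has_real_derivative 2 * max 0 t) (at t)"
proof -
  consider "t < 0" | "t = 0" | "t > 0" by linarith
  then show ?thesis
  proof cases
    case 1
    have "((\<lambda>t. 0) has_real_derivative 2 * max 0 t) (at t)" using 1 by simp
    then show ?thesis
      by (rule has_field_derivative_transform_within_open[of _ _ _ "{..<0}"]) (use 1 in \<open>auto simp: sq_pos_def\<close>)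
  next
    case 2
    have "((\<lambda>h. sq_pos h / h) \<longlongrightarrow> 0) (at 0)"
    proof (rule Lim_null_comparison)
      show "\<forall>\<^sub>F h in at 0. norm (sq_pos h / h) \<le> \<bar>h\<bar>"
        by (auto simp: sq_pos_def max_def power2_eq_square eventually_at_filter)
      show "((\<lambda>h. \<bar>h\<bar>) \<longlongrightarrow> 0) (at (0::real))" by (auto intro!: tendsto_eq_intros)
    qed
    then show ?thesis using 2 by (simp add: DERIV_def sq_pos_def)
  next
    case 3
    have "((\<lambda>t. t\<^sup>2) has_real_derivative 2 * max 0 t) (at t)" using 3 by (auto intro!: derivative_eq_intros)
    then show ?thesis
      by (rule has_field_derivative_transform_within_open[of _ _ _ "{0<..}"]) (use 3 in \<open>auto simp: sq_pos_def\<close>)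
  qed
qed

definition rad2 :: "real^3 \<Rightarrow> real" where
  "rad2 x = (x $ 1)\<^sup>2 + (x $ 2)\<^sup>2"

text \<open>The inner \<open>sq_pos\<close> starts the descent from 1 at radius R, the outer one
  brings it to 0 at radius sqrt 2 * R, both with continuous slope.\<close>

definition cutoff :: "real \<Rightarrow> real^3 \<Rightarrow> real" where
  "cutoff R x = sq_pos (1 - sq_pos (rad2 x / R\<^sup>2 - 1))"

text \<open>The horizontal gradient of the cutoff is \<open>cutoff_slope R x\<close> times the position vector.\<close>

definition cutoff_slope :: "real \<Rightarrow> real^3 \<Rightarrow> real" where
  "cutoff_slope R x = - 8 * max 0 (1 - sq_pos (rad2 x / R\<^sup>2 - 1)) * max 0 (rad2 x / R\<^sup>2 - 1) / R\<^sup>2"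

lemma rad2_nonneg: "0 \<le> rad2 x" by (simp add: rad2_def)

lemma rad2_ge: "(x $ 1)\<^sup>2 \<le> rad2 x" "(x $ 2)\<^sup>2 \<le> rad2 x" by (simp_all add: rad2_def)

lemma cutoff_bounds: "0 \<le> cutoff R x" "cutoff R x \<le> 1"
proof -
  have "max 0 (1 - sq_pos t) \<le> 1" for t by (simp add: sq_pos_def)
  then show "cutoff R x \<le> 1" unfolding cutoff_def sq_pos_def[of "1 - _"] by (intro power_le_one) auto
qed (simp add: cutoff_def sq_pos_def)

lemma cutoff_eq_1:
  assumes "0 < R" "rad2 x \<le> R\<^sup>2"
  shows "cutoff R x = 1"
  using assms by (simp add: cutoff_def sq_pos_def divide_le_eq)

lemma outer_slope_0:
  assumes "0 < R" "2 * R\<^sup>2 \<le> rad2 x"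
  shows "max 0 (1 - sq_pos (rad2 x / R\<^sup>2 - 1)) = 0"
proof -
  have "1 \<le> rad2 x / R\<^sup>2 - 1" using assms by (simp add: le_divide_eq)
  then have "1 \<le> sq_pos (rad2 x / R\<^sup>2 - 1)" by (simp add: sq_pos_def)
  then show ?thesis by simp
qed

lemma cutoff_eq_0:
  assumes "0 < R" "2 * R\<^sup>2 \<le> rad2 x"
  shows "cutoff R x = 0"
  using outer_slope_0[OF assms] by (simp add: cutoff_def sq_pos_def[of "1 - _"])

lemma cutoff_slope_nonzero:
  assumes "0 < R" "cutoff_slope R x \<noteq> 0"
  shows "R\<^sup>2 \<le> rad2 x" "rad2 x \<le> 2 * R\<^sup>2"
proof -
  show "rad2 x \<le> 2 * R\<^sup>2"
    using outer_slope_0[OF assms(1), of x] assms(2) by (cases "2 * R\<^sup>2 \<le> rad2 x") (simp_all add: cutoff_slope_def)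
  show "R\<^sup>2 \<le> rad2 x"
  proof (rule ccontr)
    assume "\<not> ?thesis"
    then have "rad2 x / R\<^sup>2 - 1 \<le> 0" using assms(1) by (simp add: divide_le_eq)
    then have "max 0 (rad2 x / R\<^sup>2 - 1) = 0" by simp
    with assms(2) show False by (simp add: cutoff_slope_def)
  qed
qed

lemma cutoff_slope_bound:
  assumes "0 < R"
  shows "\<bar>cutoff_slope R x\<bar> \<le> 8 / R\<^sup>2"
proof (cases "cutoff_slope R x = 0")
  case False
  have "rad2 x / R\<^sup>2 - 1 \<le> 1"
    using cutoff_slope_nonzero[OF assms False] assms by (simp add: divide_le_eq)
  then have "max 0 (1 - sq_pos (rad2 x / R\<^sup>2 - 1)) * max 0 (rad2 x / R\<^sup>2 - 1) \<le> 1 * 1"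
    by (intro mult_mono) (auto simp: sq_pos_def)
  then show ?thesis
    using assms by (simp add: cutoff_slope_def abs_mult divide_right_mono mult.assoc)
qed simp

lemma C1_cutoff: "C1 (cutoff R)"
  and pd_cutoff: "pd i (cutoff R) x = (if i = 3 then 0 else cutoff_slope R x * x $ i)"
proof -
  have r: "C1 (\<lambda>x. (1 / R\<^sup>2) * ((x $ 1) * (x $ 1) + (x $ 2) * (x $ 2)) - 1)" (is "C1 ?r")
    by (intro C1_intros)
  have rr: "?r x = rad2 x / R\<^sup>2 - 1" for x by (simp add: rad2_def power2_eq_square)
  have pr: "pd i ?r x = (if i = 3 then 0 else 2 * x $ i / R\<^sup>2)" for x
  proof -
    have "pd i ?r x = 1 / R\<^sup>2 * (pd i (\<lambda>x. x $ 1) x * x $ 1 + x $ 1 * pd i (\<lambda>x. x $ 1) x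
        + (pd i (\<lambda>x. x $ 2) x * x $ 2 + x $ 2 * pd i (\<lambda>x. x $ 2) x))"
      by (subst pd_diff pd_mult pd_add; (intro C1_intros)?)+ (simp add: pd_const)
    then show ?thesis using exhaust_3[of i] by (auto simp: pd_coord)
  qed
  have m: "continuous_on UNIV (\<lambda>t::real. 2 * max 0 t)" by (intro continuous_intros)
  note s = C1_compose[OF r sq_pos_deriv m]
  have r2: "C1 (\<lambda>x. 1 - sq_pos (?r x))" (is "C1 ?s") by (intro C1_intros s)
  have ps: "pd i ?s x = - (2 * max 0 (?r x) * pd i ?r x)"
    using pd_diff[OF C1_const s(1), of i 1 x] s(2)[of i x] by (simp only: pd_const)
  note t = C1_compose[OF r2 sq_pos_deriv m]
  have eq: "cutoff R = (\<lambda>x. sq_pos (?s x))" by (simp add: fun_eq_iff cutoff_def rad2_def power2_eq_square)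
  show "C1 (cutoff R)" unfolding eq by (rule t)
  \<comment> \<open>The 8 in \<open>cutoff_slope\<close> collects a factor 2 from each of the outer
    square, the inner square and the square in \<open>rad2\<close>.\<close>
  show "pd i (cutoff R) x = (if i = 3 then 0 else cutoff_slope R x * x $ i)"
    unfolding eq t(2) ps pr by (simp only: rr cutoff_slope_def) simp
qed

lemma continuous_on_cutoff_slope: "continuous_on S (cutoff_slope R)"
proof -
  have "continuous_on S (\<lambda>x. - 8 * max 0 (1 - sq_pos (rad2 x / R\<^sup>2 - 1)) * max 0 (rad2 x / R\<^sup>2 - 1) * (1 / R\<^sup>2))"
    unfolding rad2_def sq_pos_def power_divide divide_inverse by (intro continuous_intros)
  then show ?thesis unfolding cutoff_slope_def[abs_def] by simp
qed

lemma pd_cutoff_nonzero: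
  assumes "0 < R" "pd i (cutoff R) x \<noteq> 0"
  shows "R\<^sup>2 \<le> rad2 x" "rad2 x \<le> 2 * R\<^sup>2"
  using cutoff_slope_nonzero[OF assms(1), of x] assms(2) by (auto simp: pd_cutoff split: if_splits)

lemma pd_cutoff_bound:
  assumes "0 < R"
  shows "\<bar>pd i (cutoff R) x\<bar> \<le> 12 / R"
proof (cases "pd i (cutoff R) x = 0")
  case False
  have "i \<noteq> 3" using False by (auto simp: pd_cutoff)
  then have "(x $ i)\<^sup>2 \<le> rad2 x" using exhaust_3[of i] rad2_ge by auto
  also have "\<dots> \<le> 2 * R\<^sup>2" using pd_cutoff_nonzero[OF assms False] by simp
  \<comment> \<open>3/2 is a rational upper bound for sqrt 2; together with the slope bound 8 / R^2
    it yields the constant 12.\<close>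
  also have "\<dots> \<le> (3 / 2 * R)\<^sup>2" by (simp add: power_mult_distrib power2_eq_square)
  finally have "\<bar>x $ i\<bar> \<le> 3 / 2 * R" using assms by (simp add: abs_le_square_iff[symmetric])
  then have "\<bar>cutoff_slope R x\<bar> * \<bar>x $ i\<bar> \<le> 8 / R\<^sup>2 * (3 / 2 * R)"
    using assms by (intro mult_mono cutoff_slope_bound) auto
  then show ?thesis using \<open>i \<noteq> 3\<close> assms by (simp add: pd_cutoff abs_mult power2_eq_square)
qed (use assms in simp)

lemma cutoff_outside_box:
  assumes "0 < R" "2 * R \<le> K" "\<bar>x $ 1\<bar> \<ge> K \<or> \<bar>x $ 2\<bar> \<ge> K"
  shows "cutoff R x = 0"
proof -
  have "2 * R\<^sup>2 \<le> (2 * R)\<^sup>2" by (simp add: power_mult_distrib)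
  also have "\<dots> \<le> K\<^sup>2" using assms by (intro power_mono) auto
  also have "K\<^sup>2 \<le> rad2 x"
  proof -
    have "0 \<le> K" using assms by linarith
    then have "K\<^sup>2 \<le> \<bar>x $ 1\<bar>\<^sup>2 \<or> K\<^sup>2 \<le> \<bar>x $ 2\<bar>\<^sup>2" using assms(3) by (meson power_mono)
    then show ?thesis using rad2_ge[of x] by auto
  qed
  finally show ?thesis by (intro cutoff_eq_0 assms)
qed

text \<open>Where the smaller cutoff is nonzero the larger one is already 1; hence the requirement
  that the radii differ by a factor of at least sqrt 2.\<close>

lemma cutoff_mono:
  assumes "0 < R" "2 * R\<^sup>2 \<le> S\<^sup>2" "0 < S"
  shows "cutoff R x \<le> cutoff S x"
  using assms cutoff_eq_0[of R x] cutoff_eq_1[of S x] cutoff_bounds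
  by (metis linorder_not_le order.trans order_le_less)

section \<open>Periodicity\<close>

definition zperiodic :: "real \<Rightarrow> (real^3 \<Rightarrow> 'a) \<Rightarrow> bool" where
  "zperiodic L f \<longleftrightarrow> (\<forall>x. f (x + L *\<^sub>R axis 3 1) = f x)"

lemma zperiodicD: "zperiodic L f \<Longrightarrow> f (x + L *\<^sub>R axis 3 1) = f x"
  by (simp add: zperiodic_def)

lemma pd_shift:
  assumes "C1 f"
  shows "C1 (\<lambda>x. f (x + a))" "pd i (\<lambda>x. f (x + a)) x = pd i f (x + a)"
proof -
  have d: "((\<lambda>x. f (x + a)) has_derivative frechet_derivative f (at (x + a))) (at x)" for x
  proof -
    have "((\<lambda>x. x + a) has_derivative (\<lambda>h. h)) (at x)"
      by (auto intro!: derivative_eq_intros)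
    from has_derivative_compose[OF this C1_has_derivative_frechet[OF assms]] show ?thesis .
  qed
  show "pd i (\<lambda>x. f (x + a)) x = pd i f (x + a)" using pdI[OF d] by (simp add: pd_def)
  have "continuous_on UNIV (\<lambda>x. pd i f (x + a))" for i
    by (rule continuous_on_compose2[OF C1_pd_cont[OF assms, of UNIV]]) (auto intro!: continuous_intros)
  then show "C1 (\<lambda>x. f (x + a))" by (intro C1_I[OF d]) (simp add: pd_def)
qed

lemma zperiodic_pd:
  assumes "C1 f" "zperiodic L f"
  shows "zperiodic L (pd i f)"
proof -
  have "(\<lambda>x. f (x + L *\<^sub>R axis 3 1)) = f" using assms(2) by (auto simp: zperiodic_def)
  then show ?thesis using pd_shift(2)[OF assms(1), of i "L *\<^sub>R axis 3 1"] by (simp add: zperiodic_def)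
qed

lemma pt_shift: "pt (x, y, z) + L *\<^sub>R axis 3 1 = pt (x, y, z + L)"
  by (simp add: vec_eq_iff forall_3 axis_def)

lemma zperiodic_pt: "zperiodic L f \<Longrightarrow> f (pt (x, y, L)) = f (pt (x, y, 0))"
  using zperiodicD[of L f "pt (x, y, 0)"] by (simp add: pt_shift)

lemma zperiodic_cutoff: "zperiodic L (cutoff R)"
  by (simp add: zperiodic_def cutoff_def rad2_def axis_def)

lemma slab_by_parts:
  assumes f: "C1 f" "zperiodic L f" and p: "C1 p" "zperiodic L p"
    and 0: "\<And>x. \<bar>x $ 1\<bar> \<ge> K \<or> \<bar>x $ 2\<bar> \<ge> K \<Longrightarrow> p x = 0" and "0 \<le> L" "0 \<le> K"
  shows "slab_int L K (\<lambda>x. pd i p x * f x + p x * pd i f x) = 0"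
proof -
  have "slab_int L K (pd i (\<lambda>x. p x * f x)) = 0"
    using assms zperiodic_pt[OF f(2)] zperiodic_pt[OF p(2)] by (intro slab_pd C1_mult) auto
  moreover have "pd i (\<lambda>x. p x * f x) = (\<lambda>x. pd i p x * f x + p x * pd i f x)"
    by (auto simp: pd_mult[OF p(1) f(1)])
  ultimately show ?thesis by simp
qed

section \<open>A priori bounds for bounded periodic flows\<close>

lemma square_sum3_le: "(a + b + c)\<^sup>2 \<le> 3 * (a\<^sup>2 + b\<^sup>2 + (c::real)\<^sup>2)"
proof -
  have "0 \<le> (a - b)\<^sup>2 + (b - c)\<^sup>2 + (a - c)\<^sup>2" by simp
  then show ?thesis by (simp add: power2_eq_square algebra_simps)
qed

lemma sum3_square_le: "(\<Sum>i\<in>(UNIV::3 set). f i)\<^sup>2 \<le> 3 * (\<Sum>i\<in>UNIV. (f i :: real)\<^sup>2)"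
  using square_sum3_le[of "f 1" "f 2" "f 3"] by (simp add: sum_3)

lemma young: "0 < e \<Longrightarrow> a * b \<le> e * a\<^sup>2 + b\<^sup>2 / (4 * (e::real))"
proof -
  assume e: "0 < e"
  have "0 \<le> (2 * e * a - b)\<^sup>2" by simp
  then have "(a * b) * (4 * e) \<le> (e * a\<^sup>2) * (4 * e) + b\<^sup>2"
    by (simp add: power2_eq_square algebra_simps)
  then show ?thesis using e by (simp add: field_simps)
qed

text \<open>Scalar form of the integrand met when testing with the vorticity: \<open>a\<close>
  stands for a component of the Laplacian, \<open>n\<close> for the convection term,
  \<open>e\<close> for the cutoff gradient paired with the vorticity. In terms of
  \<open>A = p^2 * a\<close> the cross terms cost at most half of \<open>A^2\<close>, and the
  remainder keeps the weight \<open>p^2\<close>. This fixes the fourth power of the cutoff.\<close>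

lemma cutoff_young:
  fixes p a n e :: real
  assumes "0 \<le> p" "p \<le> 1"
  shows "p^4 * a\<^sup>2 / 2 - 2 * p\<^sup>2 * (e\<^sup>2 + n\<^sup>2) \<le> (a - n) * (p^4 * a + p^3 * e)"
proof -
  define A where "A = p\<^sup>2 * a"
  have p: "p\<^sup>2 * n\<^sup>2 * p\<^sup>2 \<le> p\<^sup>2 * n\<^sup>2 * 1" "p\<^sup>2 * p * (e\<^sup>2 + n\<^sup>2) \<le> p\<^sup>2 * 1 * (e\<^sup>2 + n\<^sup>2)"
    using assms by (intro mult_left_mono mult_right_mono power_le_one; simp)+
  have "0 \<le> (A / 2 + p * e)\<^sup>2" "0 \<le> (A / 2 - p\<^sup>2 * n)\<^sup>2" "0 \<le> p\<^sup>2 * p * (e - n)\<^sup>2" 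
    using assms by simp_all
  then have "- (A\<^sup>2 / 4 + p\<^sup>2 * e\<^sup>2) \<le> A * (p * e)" "A * (p\<^sup>2 * n) \<le> A\<^sup>2 / 4 + p\<^sup>2 * n\<^sup>2 * p\<^sup>2"
    "2 * (p\<^sup>2 * p * (n * e)) \<le> p\<^sup>2 * p * (e\<^sup>2 + n\<^sup>2)"
    by (simp_all add: power2_eq_square algebra_simps)
  moreover have "(a - n) * (p^4 * a + p^3 * e) = A\<^sup>2 + A * (p * e) - A * (p\<^sup>2 * n) - p\<^sup>2 * p * (n * e)"
    by (simp add: A_def power2_eq_square algebra_simps power3_eq_cube power4_eq_xxxx)
  moreover have "p^4 * a\<^sup>2 = A\<^sup>2" by (simp add: A_def power2_eq_square power4_eq_xxxx)
  moreover have "0 \<le> p\<^sup>2 * e\<^sup>2" "0 \<le> p\<^sup>2 * n\<^sup>2" by simp_all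
  moreover have "p\<^sup>2 * 1 * (e\<^sup>2 + n\<^sup>2) = p\<^sup>2 * e\<^sup>2 + p\<^sup>2 * n\<^sup>2"
    "2 * p\<^sup>2 * (e\<^sup>2 + n\<^sup>2) = 2 * (p\<^sup>2 * e\<^sup>2) + 2 * (p\<^sup>2 * n\<^sup>2)" by (simp_all add: algebra_simps)
  ultimately show ?thesis using p by linarith
qed

section \<open>Bounded periodic solutions: velocity gradient, vorticity, pointwise bounds\<close>

locale periodic_flow =
  fixes U :: "3 \<Rightarrow> real^3 \<Rightarrow> real" and P :: "real^3 \<Rightarrow> real" and M L :: real
  assumes smooth_U: "smooth (U i)" and smooth_P: "smooth P"
    and NS: "(\<Sum>i\<in>UNIV. pd i (pd i (U j)) x) = (\<Sum>i\<in>UNIV. U i x * pd i (U j) x) + pd j P x"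
    and div_free: "(\<Sum>i\<in>UNIV. pd i (U i) x) = 0"
    and bound: "\<bar>U i x\<bar> \<le> M"
    and periodic_U: "zperiodic L (U i)"
    and L_pos: "0 < L"
begin

definition lap :: "3 \<Rightarrow> real^3 \<Rightarrow> real" where
  "lap j x = (\<Sum>i\<in>UNIV. pd i (pd i (U j)) x)"

definition conv :: "3 \<Rightarrow> real^3 \<Rightarrow> real" where
  "conv j x = (\<Sum>i\<in>UNIV. U i x * pd i (U j) x)"

definition Q :: "real^3 \<Rightarrow> real" where
  "Q x = (\<Sum>j\<in>UNIV. \<Sum>i\<in>UNIV. (pd i (U j) x)\<^sup>2)"

text \<open>The curl, encoded as an antisymmetric matrix: antisymmetry is what annihilates the
  Hessian of the pressure, and the divergence in the first index is the Laplacian.\<close>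

definition vort :: "3 \<Rightarrow> 3 \<Rightarrow> real^3 \<Rightarrow> real" where
  "vort i j x = pd i (U j) x - pd j (U i) x"

lemma C1_U: "C1 (U i)" and C1_dU: "C1 (pd j (U i))" and C1_P: "C1 P" and C1_dP: "C1 (pd j P)"
  by (simp_all add: smooth_imp_C1 smooth_pd smooth_U smooth_P)

lemma C1_vort: "C1 (vort i j)"
  unfolding vort_def[abs_def] by (intro C1_diff C1_dU)

lemma P_eq: "pd j P x = lap j x - conv j x"
  using NS[of j x] by (simp add: lap_def conv_def)

lemma periodic_dU: "zperiodic L (pd j (U i))"
  by (rule zperiodic_pd[OF C1_U periodic_U])

lemma periodic_ddU: "zperiodic L (pd k (pd j (U i)))"
  by (rule zperiodic_pd[OF C1_dU periodic_dU])

lemma periodic_vort: "zperiodic L (vort i j)"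
  using periodic_dU by (simp add: vort_def zperiodic_def)

lemma periodic_dP: "zperiodic L (pd j P)"
  using periodic_U periodic_dU periodic_ddU
  by (simp add: zperiodic_def P_eq lap_def conv_def)

lemma continuous_flow:
  "continuous_on UNIV (U i)" "continuous_on UNIV (pd j (U i))" "continuous_on UNIV (pd k (pd j (U i)))"
  "continuous_on UNIV (vort i j)" "continuous_on UNIV (pd k (vort i j))"
  "continuous_on UNIV P" "continuous_on UNIV (pd j P)" "continuous_on UNIV (pd k (pd j P))"
  "continuous_on UNIV (cutoff R)" "continuous_on UNIV (pd i (cutoff R))"
  by (intro C1_cont C1_pd_cont C1_U C1_dU C1_P C1_dP C1_vort C1_cutoff)+

lemma continuous_lap: "continuous_on UNIV (lap i)" "continuous_on UNIV (conv i)" "continuous_on UNIV Q"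
  unfolding lap_def[abs_def] conv_def[abs_def] Q_def[abs_def]
  by (intro continuous_intros continuous_flow)+

lemmas cts = continuous_intros continuous_flow continuous_lap

lemma M_nonneg: "0 \<le> M" using bound[of 1 0] by linarith

lemma Q_nonneg: "0 \<le> Q x" unfolding Q_def by (intro sum_nonneg) auto

lemma U_square_le: "(U i x)\<^sup>2 \<le> M\<^sup>2"
  using bound[of i x] by (metis abs_ge_zero power2_abs power_mono)

lemma conv_bound: "(conv j x)\<^sup>2 \<le> 3 * M\<^sup>2 * (\<Sum>i\<in>UNIV. (pd i (U j) x)\<^sup>2)"
proof -
  have "(conv j x)\<^sup>2 \<le> 3 * (\<Sum>i\<in>UNIV. (U i x * pd i (U j) x)\<^sup>2)"
    unfolding conv_def by (rule sum3_square_le)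
  also have "\<dots> \<le> 3 * (\<Sum>i\<in>UNIV. M\<^sup>2 * (pd i (U j) x)\<^sup>2)"
    by (intro mult_left_mono sum_mono) (auto simp: power_mult_distrib intro!: mult_right_mono U_square_le)
  finally show ?thesis by (simp add: sum_distrib_left mult_ac)
qed

lemma conv_sum_bound: "(\<Sum>j\<in>UNIV. (conv j x)\<^sup>2) \<le> 3 * M\<^sup>2 * Q x"
  using sum_mono[of UNIV "\<lambda>j. (conv j x)\<^sup>2", OF conv_bound] by (simp add: Q_def sum_distrib_left)

lemma vort_bound: "(\<Sum>j\<in>UNIV. \<Sum>i\<in>UNIV. (vort i j x)\<^sup>2) \<le> 4 * Q x"
proof -
  have "(vort i j x)\<^sup>2 \<le> 2 * (pd i (U j) x)\<^sup>2 + 2 * (pd j (U i) x)\<^sup>2" for i j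
  proof -
    have "0 \<le> (pd i (U j) x + pd j (U i) x)\<^sup>2" by simp
    then show ?thesis by (simp add: vort_def power2_eq_square algebra_simps)
  qed
  then have "(\<Sum>j\<in>UNIV. \<Sum>i\<in>UNIV. (vort i j x)\<^sup>2)
      \<le> (\<Sum>j\<in>UNIV. \<Sum>i\<in>UNIV. 2 * (pd i (U j) x)\<^sup>2 + 2 * (pd j (U i) x)\<^sup>2)"
    by (intro sum_mono)
  also have "\<dots> = 4 * Q x" by (simp add: Q_def sum_3)
  finally show ?thesis .
qed

text \<open>After commuting derivatives the second half of the vorticity contributes the gradient of
  the divergence of the velocity, which is zero.\<close>

lemma vort_div: "(\<Sum>i\<in>UNIV. pd i (vort i j) x) = lap j x"
proof -
  have "pd j (\<lambda>x. \<Sum>i\<in>UNIV. pd i (U i) x) x = (\<Sum>i\<in>UNIV. pd j (pd i (U i)) x)"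
    by (rule C1_sum(2)) (simp_all add: C1_dU)
  also have "(\<lambda>x. \<Sum>i\<in>UNIV. pd i (U i) x) = (\<lambda>x. 0)" by (simp add: div_free)
  finally have "(\<Sum>i\<in>UNIV. pd j (pd i (U i)) x) = 0" by (simp add: pd_const)
  moreover have "pd i (vort i j) x = pd i (pd i (U j)) x - pd j (pd i (U i)) x" for i
    unfolding vort_def[abs_def] by (simp add: pd_diff C1_dU pd_commute[OF C1_U C1_dU C1_dU, of i j])
  ultimately show ?thesis by (simp add: lap_def sum_subtractf)
qed

text \<open>A symmetric matrix contracted with an antisymmetric one.\<close>

lemma hess_vort: "(\<Sum>j\<in>UNIV. \<Sum>i\<in>UNIV. pd i (pd j P) x * vort i j x) = 0"
proof -
  have c: "pd 2 (pd 1 P) x = pd 1 (pd 2 P) x" "pd 3 (pd 1 P) x = pd 1 (pd 3 P) x"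
    "pd 3 (pd 2 P) x = pd 2 (pd 3 P) x"
    by (rule pd_commute[OF C1_P C1_dP C1_dP])+
  show ?thesis by (simp add: sum_3 c vort_def algebra_simps)
qed

lemma slab_sum2:
  assumes "\<And>i j. continuous_on UNIV (f i j)"
  shows "slab_int L K (\<lambda>x. \<Sum>j\<in>(UNIV::3 set). \<Sum>i\<in>(UNIV::3 set). f i j x)
    = (\<Sum>j\<in>UNIV. \<Sum>i\<in>UNIV. slab_int L K (f i j))"
  using assms by (subst slab_sum; (intro continuous_intros)?; simp add: slab_sum)+

text \<open>The divergence of an antisymmetric tensor is divergence free, so testing the equation with the
  divergence of \<open>cutoff\<^sup>4 * vort\<close> eliminates the pressure.\<close>

lemma laplacian_le_gradient:
  assumes R: "1 \<le> R" and K: "2 * R \<le> K"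
  shows "slab_int L K (\<lambda>x. cutoff R x ^ 4 * (\<Sum>j\<in>UNIV. (lap j x)\<^sup>2))
    \<le> 12 * (36864 + M\<^sup>2) * slab_int L K (\<lambda>x. (cutoff R x)\<^sup>2 * Q x)"
proof -
  let ?p = "cutoff R"
  define p4 where "p4 = (\<lambda>x. ?p x * ?p x * (?p x * ?p x))"
  have p4: "C1 p4" unfolding p4_def by (intro C1_intros C1_cutoff)
  have p4': "p4 x = ?p x ^ 4" for x by (simp add: p4_def power4_eq_xxxx)
  have dp4: "pd i p4 x = 4 * ?p x ^ 3 * pd i ?p x" for i x
    unfolding p4_def by (simp add: pd_mult C1_mult C1_cutoff power3_eq_cube algebra_simps)
  define e where "e = (\<lambda>j x. \<Sum>i\<in>UNIV. 4 * pd i ?p x * vort i j x)"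
  define F where "F = (\<lambda>i j x. pd j P x * vort i j x)"
  have F: "C1 (F i j)" for i j unfolding F_def by (intro C1_intros C1_dP C1_vort)
  \<comment> \<open>\<open>Z\<close> is the divergence of \<open>p4\<close> times the vorticity
    matrix applied to the pressure gradient, so it integrates to zero. \<open>Zeq\<close> shows the
    other face of \<open>Z\<close>: the Hessian drops out and \<open>P_eq\<close> replaces the
    pressure gradient by \<open>lap - conv\<close>.\<close>
  define Z where "Z = (\<lambda>x. \<Sum>j\<in>UNIV. \<Sum>i\<in>UNIV. pd i p4 x * F i j x + p4 x * pd i (F i j) x)"
  have cZ: "continuous_on UNIV Z" unfolding Z_def
    by (intro cts C1_pd_cont[OF p4] C1_pd_cont[OF F] C1_cont[OF p4] C1_cont[OF F])
  have "slab_int L K (\<lambda>x. pd i p4 x * F i j x + p4 x * pd i (F i j) x) = 0" for i j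
  proof (rule slab_by_parts[OF F _ p4])
    show "zperiodic L (F i j)" using periodic_dP periodic_vort by (simp add: F_def zperiodic_def)
    show "zperiodic L p4" using zperiodic_cutoff by (simp add: p4_def zperiodic_def)
    show "p4 x = 0" if "\<bar>x $ 1\<bar> \<ge> K \<or> \<bar>x $ 2\<bar> \<ge> K" for x
      using cutoff_outside_box[OF _ K that] R by (simp add: p4_def)
  qed (use R K L_pos in auto)
  then have Z0: "slab_int L K Z = 0"
    unfolding Z_def
    by (subst slab_sum2) (intro cts C1_pd_cont[OF p4] C1_pd_cont[OF F] C1_cont[OF p4] C1_cont[OF F], simp)
  have Zeq: "Z x = (\<Sum>j\<in>UNIV. (lap j x - conv j x) * (?p x ^ 4 * lap j x + ?p x ^ 3 * e j x))" for x
  proof -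
    have "pd i (F i j) x = pd i (pd j P) x * vort i j x + pd j P x * pd i (vort i j) x" for i j
      unfolding F_def by (rule pd_mult[OF C1_dP C1_vort])
    then have "Z x = (\<Sum>j\<in>UNIV. \<Sum>i\<in>UNIV. (?p x ^ 4 * (pd i (pd j P) x * vort i j x)
        + pd j P x * (?p x ^ 4 * pd i (vort i j) x + ?p x ^ 3 * (4 * pd i ?p x * vort i j x))))"
      unfolding Z_def by (simp add: F_def dp4 p4' algebra_simps)
    also have "\<dots> = ?p x ^ 4 * (\<Sum>j\<in>UNIV. \<Sum>i\<in>UNIV. pd i (pd j P) x * vort i j x)
        + (\<Sum>j\<in>UNIV. pd j P x * (?p x ^ 4 * (\<Sum>i\<in>UNIV. pd i (vort i j) x) + ?p x ^ 3 * e j x))"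
      unfolding e_def by (simp add: sum.distrib sum_distrib_left[symmetric] distrib_left)
    finally show ?thesis by (simp only: hess_vort vort_div P_eq mult_zero_right add_0)
  qed
  \<comment> \<open>27648 = 3 * (4 * 12)^2 * 4, from the square of a three-term sum, the bound 12 on
    the cutoff gradient, and \<open>vort_bound\<close>; the last factor 4 is slack. It reappears
    below through 6 * 36864 = 2 * 4 * 27648.\<close>
  have eb: "(\<Sum>j\<in>UNIV. (e j x)\<^sup>2) \<le> 27648 * Q x * 4" for x
  proof -
    have "(e j x)\<^sup>2 \<le> 3 * (\<Sum>i\<in>UNIV. 2304 * (vort i j x)\<^sup>2)" for j
    proof -
      have "\<bar>pd i ?p x\<bar> \<le> 12" for i
        using order_trans[OF pd_cutoff_bound[of R i x], of 12] R by (simp add: divide_le_eq)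
      then have "(pd i ?p x)\<^sup>2 \<le> 12\<^sup>2" for i
        using power_mono[of "\<bar>pd i ?p x\<bar>" 12 2] by simp
      then have "16 * (pd i ?p x)\<^sup>2 * (vort i j x)\<^sup>2 \<le> 16 * 12\<^sup>2 * (vort i j x)\<^sup>2" for i
        by (intro mult_right_mono mult_left_mono) auto
      then have "(\<Sum>i\<in>UNIV. (4 * pd i ?p x * vort i j x)\<^sup>2) \<le> (\<Sum>i\<in>UNIV. 2304 * (vort i j x)\<^sup>2)"
        by (intro sum_mono) (simp add: power_mult_distrib)
      with sum3_square_le[of "\<lambda>i. 4 * pd i ?p x * vort i j x"] show ?thesis
        unfolding e_def by linarith
    qed
    then have "(\<Sum>j\<in>UNIV. (e j x)\<^sup>2) \<le> (\<Sum>j\<in>UNIV. 3 * (\<Sum>i\<in>UNIV. 2304 * (vort i j x)\<^sup>2))" 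
      by (intro sum_mono)
    also have "\<dots> = 6912 * (\<Sum>j\<in>UNIV. \<Sum>i\<in>UNIV. (vort i j x)\<^sup>2)"
      by (simp add: sum_distrib_left[symmetric])
    also have "\<dots> \<le> 6912 * (4 * Q x)" by (intro mult_left_mono vort_bound) auto
    finally show ?thesis using Q_nonneg[of x] by simp
  qed
  have pw: "1 / 2 * (?p x ^ 4 * (\<Sum>j\<in>UNIV. (lap j x)\<^sup>2)) \<le> Z x + 6 * (36864 + M\<^sup>2) * ((?p x)\<^sup>2 * Q x)" for x
  proof -
    have "(\<Sum>j\<in>UNIV. ?p x ^ 4 * (lap j x)\<^sup>2 / 2 - 2 * (?p x)\<^sup>2 * ((e j x)\<^sup>2 + (conv j x)\<^sup>2)) \<le> Z x"
      unfolding Zeq by (intro sum_mono cutoff_young cutoff_bounds)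
    then have "1 / 2 * (?p x ^ 4 * (\<Sum>j\<in>UNIV. (lap j x)\<^sup>2))
        \<le> Z x + 2 * (?p x)\<^sup>2 * ((\<Sum>j\<in>UNIV. (e j x)\<^sup>2) + (\<Sum>j\<in>UNIV. (conv j x)\<^sup>2))"
      by (simp add: sum_subtractf sum.distrib sum_distrib_left sum_divide_distrib distrib_left)
    also have "\<dots> \<le> Z x + 2 * (?p x)\<^sup>2 * (27648 * Q x * 4 + 3 * M\<^sup>2 * Q x)"
      by (intro add_left_mono mult_left_mono add_mono eb conv_sum_bound) auto
    finally show ?thesis by (simp add: algebra_simps)
  qed
  have "1 / 2 * slab_int L K (\<lambda>x. ?p x ^ 4 * (\<Sum>j\<in>UNIV. (lap j x)\<^sup>2))
      = slab_int L K (\<lambda>x. 1 / 2 * (?p x ^ 4 * (\<Sum>j\<in>UNIV. (lap j x)\<^sup>2)))"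
    by (simp only: slab_cmult)
  also have "\<dots> \<le> slab_int L K (\<lambda>x. Z x + 6 * (36864 + M\<^sup>2) * ((?p x)\<^sup>2 * Q x))"
    by (intro slab_mono pw cts cZ)
  also have "\<dots> = 6 * (36864 + M\<^sup>2) * slab_int L K (\<lambda>x. (?p x)\<^sup>2 * Q x)"
    by (subst slab_add) (intro cZ cts, intro cts, simp only: Z0 slab_cmult)
  finally show ?thesis by (simp add: algebra_simps)
qed

text \<open>The two energies bound each other: the Laplacian by the gradient as above, and the gradient by a
  small multiple of the Laplacian after one integration by parts.\<close>

lemma gradient_growth:
  "\<exists>C\<ge>0. \<forall>R K. 1 \<le> R \<longrightarrow> 2 * R \<le> K \<longrightarrow>
    slab_int L K (\<lambda>x. (cutoff R x)\<^sup>2 * Q x) \<le> C * K\<^sup>2 \<and>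
    slab_int L K (\<lambda>x. cutoff R x ^ 4 * (\<Sum>j\<in>UNIV. (lap j x)\<^sup>2)) \<le> C * K\<^sup>2"
proof -
  define A where "A = 12 * (36864 + M\<^sup>2)"
  have A: "A > 0" by (simp add: A_def add_pos_nonneg)
  \<comment> \<open>With this \<open>d\<close> the Laplacian term costs a quarter of the gradient
    energy. The cutoff term costs another quarter, so both are absorbed on the left.\<close>
  define d where "d = 1 / (4 * A)"
  have d: "d > 0" using A by (simp add: d_def)
  \<comment> \<open>The constant left by Young's inequality: \<open>M^2 / (4 * d)\<close> for each
    of three components, and 576 = (2 * 12)^2 times \<open>M^2\<close> for each of nine index
    pairs.\<close>
  define D where "D = 3 * M\<^sup>2 / (4 * d) + 5184 * M\<^sup>2"
  have D: "D \<ge> 0" using d by (simp add: D_def)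
  define C where "C = (1 + A) * (8 * L * D)"
  have C: "C \<ge> 8 * L * D" "C \<ge> A * (8 * L * D)" "C \<ge> 0"
    using A D L_pos by (simp_all add: C_def algebra_simps)
  have "slab_int L K (\<lambda>x. (cutoff R x)\<^sup>2 * Q x) \<le> C * K\<^sup>2 \<and>
      slab_int L K (\<lambda>x. cutoff R x ^ 4 * (\<Sum>j\<in>UNIV. (lap j x)\<^sup>2)) \<le> C * K\<^sup>2"
    if R: "1 \<le> R" and K: "2 * R \<le> K" for R K
  proof -
    let ?p = "cutoff R"
    define p2 where "p2 = (\<lambda>x. ?p x * ?p x)"
    have p2: "C1 p2" unfolding p2_def by (intro C1_intros C1_cutoff)
    have p2': "p2 x = ?p x ^ 2" for x by (simp add: p2_def power2_eq_square)
    have dp2: "pd i p2 x = 2 * ?p x * pd i ?p x" for i x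
      unfolding p2_def by (simp add: pd_mult C1_cutoff)
    define F where "F = (\<lambda>i j x. U j x * pd i (U j) x)"
    have F: "C1 (F i j)" for i j unfolding F_def by (intro C1_intros C1_U C1_dU)
    have dF: "pd i (F i j) x = pd i (U j) x * pd i (U j) x + U j x * pd i (pd i (U j)) x" for i j x
      unfolding F_def by (rule pd_mult[OF C1_U C1_dU])
    define Z where "Z = (\<lambda>x. \<Sum>j\<in>UNIV. \<Sum>i\<in>UNIV. pd i p2 x * F i j x + p2 x * pd i (F i j) x)"
    have cZ: "continuous_on UNIV Z" unfolding Z_def
      by (intro cts C1_pd_cont[OF p2] C1_pd_cont[OF F] C1_cont[OF p2] C1_cont[OF F])
    have "slab_int L K (\<lambda>x. pd i p2 x * F i j x + p2 x * pd i (F i j) x) = 0" for i j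
    proof (rule slab_by_parts[OF F _ p2])
      show "zperiodic L (F i j)" using periodic_U periodic_dU by (simp add: F_def zperiodic_def)
      show "zperiodic L p2" using zperiodic_cutoff by (simp add: p2_def zperiodic_def)
      show "p2 x = 0" if "\<bar>x $ 1\<bar> \<ge> K \<or> \<bar>x $ 2\<bar> \<ge> K" for x
        using cutoff_outside_box[OF _ K that] R by (simp add: p2_def)
    qed (use R K L_pos in auto)
    then have Z0: "slab_int L K Z = 0"
      unfolding Z_def
      by (subst slab_sum2) (intro cts C1_pd_cont[OF p2] C1_pd_cont[OF F] C1_cont[OF p2] C1_cont[OF F], simp)
    have pw: "(?p x)\<^sup>2 * Q x \<le> Z x + (d * (?p x ^ 4 * (\<Sum>j\<in>UNIV. (lap j x)\<^sup>2))
        + (1 / 4 * ((?p x)\<^sup>2 * Q x) + D))" for x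
    proof -
      have a: "- (2 * ?p x * pd i ?p x * (U j x * pd i (U j) x))
          \<le> 1 / 4 * ((?p x)\<^sup>2 * (pd i (U j) x)\<^sup>2) + 576 * M\<^sup>2" for i j
      proof -
        have "\<bar>pd i ?p x\<bar> \<le> 12"
          using order_trans[OF pd_cutoff_bound[of R i x], of 12] R by (simp add: divide_le_eq)
        then have "\<bar>pd i ?p x * U j x\<bar> \<le> 12 * M"
          unfolding abs_mult using bound M_nonneg by (intro mult_mono) auto
        then have "(pd i ?p x * U j x)\<^sup>2 \<le> (12 * M)\<^sup>2"
          by (metis abs_ge_zero power2_abs power_mono)
        moreover have "(?p x * pd i (U j) x) * (- 2 * (pd i ?p x * U j x))
            \<le> 1 / 4 * (?p x * pd i (U j) x)\<^sup>2 + (- 2 * (pd i ?p x * U j x))\<^sup>2 / (4 * (1 / 4))"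
          by (rule young) simp
        ultimately show ?thesis
          by (simp add: power_mult_distrib algebra_simps)
      qed
      have b: "- ((?p x)\<^sup>2 * (U j x * lap j x)) \<le> d * (?p x ^ 4 * (lap j x)\<^sup>2) + M\<^sup>2 / (4 * d)" for j
      proof -
        have "((?p x)\<^sup>2 * lap j x) * (- U j x) \<le> d * ((?p x)\<^sup>2 * lap j x)\<^sup>2 + (- U j x)\<^sup>2 / (4 * d)"
          by (rule young[OF d])
        also have "(- U j x)\<^sup>2 / (4 * d) \<le> M\<^sup>2 / (4 * d)"
          using d U_square_le by (intro divide_right_mono) auto
        finally show ?thesis by (simp add: power_mult_distrib algebra_simps flip: power_mult)
      qed
      have "Z x = (\<Sum>j\<in>UNIV. \<Sum>i\<in>UNIV. 2 * ?p x * pd i ?p x * (U j x * pd i (U j) x)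
         + ((?p x)\<^sup>2 * (pd i (U j) x)\<^sup>2 + (?p x)\<^sup>2 * (U j x * pd i (pd i (U j)) x)))"
        unfolding Z_def dF dp2 p2' by (simp add: F_def algebra_simps power2_eq_square)
      also have "\<dots> = (\<Sum>j\<in>UNIV. \<Sum>i\<in>UNIV. 2 * ?p x * pd i ?p x * (U j x * pd i (U j) x))
         + (?p x)\<^sup>2 * Q x + (\<Sum>j\<in>UNIV. (?p x)\<^sup>2 * (U j x * lap j x))"
        by (simp add: sum.distrib sum_distrib_left[symmetric] Q_def lap_def)
      finally have "(?p x)\<^sup>2 * Q x = Z x + (\<Sum>j\<in>UNIV. \<Sum>i\<in>UNIV. - (2 * ?p x * pd i ?p x * (U j x * pd i (U j) x)))
          + (\<Sum>j\<in>UNIV. - ((?p x)\<^sup>2 * (U j x * lap j x)))"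
        by (simp add: sum_negf)
      also have "\<dots> \<le> Z x + (\<Sum>j\<in>(UNIV::3 set). \<Sum>i\<in>(UNIV::3 set). 1 / 4 * ((?p x)\<^sup>2 * (pd i (U j) x)\<^sup>2) + 576 * M\<^sup>2)
          + (\<Sum>j\<in>(UNIV::3 set). d * (?p x ^ 4 * (lap j x)\<^sup>2) + M\<^sup>2 / (4 * d))"
        by (intro add_mono sum_mono a b order_refl)
      also have "\<dots> = Z x + (d * (?p x ^ 4 * (\<Sum>j\<in>UNIV. (lap j x)\<^sup>2))
        + (1 / 4 * ((?p x)\<^sup>2 * Q x) + D))"
        by (simp add: sum.distrib sum_distrib_left[symmetric] sum_divide_distrib[symmetric] Q_def D_def)
      finally show ?thesis .
    qed
    define B where "B = slab_int L K (\<lambda>x. (?p x)\<^sup>2 * Q x)"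
    define E where "E = slab_int L K (\<lambda>x. ?p x ^ 4 * (\<Sum>j\<in>UNIV. (lap j x)\<^sup>2))"
    have EB: "E \<le> A * B" unfolding E_def B_def A_def by (rule laplacian_le_gradient[OF R K])
    have "B \<le> slab_int L K (\<lambda>x. Z x + (d * (?p x ^ 4 * (\<Sum>j\<in>UNIV. (lap j x)\<^sup>2))
        + (1 / 4 * ((?p x)\<^sup>2 * Q x) + D)))"
      unfolding B_def by (intro slab_mono pw cts cZ)
    \<comment> \<open>The growth of order \<open>K^2\<close> is just the volume
      \<open>4 * K^2 * L\<close> of the slab multiplied by \<open>D\<close>.\<close>
    also have "\<dots> = d * E + (1 / 4 * B + 4 * K\<^sup>2 * L * D)"
      using R K L_pos unfolding E_def B_def
      by (subst slab_add; (intro cts cZ)?)+ (simp only: Z0 slab_cmult, simp add: slab_const)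
    also have "d * E \<le> d * (A * B)" using d EB by simp
    also have "d * (A * B) = B / 4" using A by (simp add: d_def)
    finally have B: "B \<le> 8 * L * D * K\<^sup>2" by (simp add: algebra_simps)
    also have "\<dots> \<le> C * K\<^sup>2" using C by (intro mult_right_mono) auto
    finally have 1: "B \<le> C * K\<^sup>2" .
    have "E \<le> A * (8 * L * D * K\<^sup>2)" using EB B A by (meson less_imp_le mult_left_mono order_trans)
    also have "\<dots> = (A * (8 * L * D)) * K\<^sup>2" by simp
    also have "\<dots> \<le> C * K\<^sup>2" using C by (intro mult_right_mono) auto
    finally show ?thesis using 1 by (simp add: B_def E_def)
  qed
  then show ?thesis using C by blast
qed

end

section \<open>The pressure is periodic\<close>

text \<open>The square of side R centred on the axis lies in the disc where the cutoff is 1.\<close>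

lemma slab_cutoff_ge:
  assumes "0 < R" "R \<le> K" "0 \<le> L"
  shows "R\<^sup>2 * L \<le> slab_int L K (cutoff R)"
proof -
  have "slab_int L (R / 2) (cutoff R) = slab_int L (R / 2) (\<lambda>x. 1)"
    unfolding slab_int_def
  proof (rule integral_cong)
    fix p assume "p \<in> cbox (- (R / 2), - (R / 2), 0) (R / 2, R / 2, L)"
    then have "\<bar>fst p\<bar> \<le> R / 2" "\<bar>fst (snd p)\<bar> \<le> R / 2" by (auto simp: cbox_Pair_eq)
    then have "(fst p)\<^sup>2 \<le> (R / 2)\<^sup>2" "(fst (snd p))\<^sup>2 \<le> (R / 2)\<^sup>2"
      using power_mono[of "\<bar>fst p\<bar>" "R / 2" 2] power_mono[of "\<bar>fst (snd p)\<bar>" "R / 2" 2] by auto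
    then have "rad2 (pt p) \<le> R\<^sup>2"
      using zero_le_power2[of R] power_divide[of R 2 2, simplified] unfolding rad2_def pt_nth' by linarith
    then show "cutoff R (pt p) = 1" by (rule cutoff_eq_1[OF assms(1)])
  qed
  also have "\<dots> = R\<^sup>2 * L" using assms by (simp add: slab_const power_divide)
  finally show ?thesis
    using slab_subset[of "cutoff R" "R / 2" K L] assms cutoff_bounds C1_cont[OF C1_cutoff] by simp
qed

context periodic_flow
begin

text \<open>The equation expresses the pressure gradient by the velocity, so the gradient is
  periodic; the pressure can therefore change over one period only by a constant.\<close>

lemma pressure_increment: "\<exists>c. \<forall>x. P (x + L *\<^sub>R axis 3 1) = P x + c"
proof -
  let ?D = "\<lambda>x. P (x + L *\<^sub>R axis 3 1) - P x"
  have c: "C1 ?D" by (intro C1_diff pd_shift C1_P)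
  have "pd i ?D x = 0" for i x
    using zperiodicD[OF periodic_dP, of i x] by (simp add: pd_diff pd_shift C1_P)
  then have "(?D has_derivative (\<lambda>h. 0)) (at x)" for x
    using C1_has_derivative[OF c, of x] by simp
  then obtain c where "\<And>x. ?D x = c"
    using has_derivative_zero_constant[of UNIV ?D] by auto
  then show ?thesis by (metis add.commute diff_add_cancel)
qed

text \<open>Vertical momentum balance against the cutoff: the drift \<open>a\<close> acts on a
  volume of at least \<open>R^2 * L\<close>, while every other term is in divergence form and meets
  only the cutoff gradient, of size 12 / R.\<close>

lemma pressure_slope_bound:
  assumes c: "\<And>x. P (x + L *\<^sub>R axis 3 1) = P x + a * L" and R: "1 \<le> R"
  shows "\<bar>a\<bar> * (R\<^sup>2 * L) \<le> 12 / R * (slab_int L (4 * R) (\<lambda>x. (cutoff (2 * R) x)\<^sup>2 * Q x) + 64 * R\<^sup>2 * L * (3 + 3 * M\<^sup>2))"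
proof -
  let ?p = "cutoff R" and ?K = "4 * R"
  \<comment> \<open>The linear function carries the whole increment over a period, which makes
    \<open>p0\<close> periodic.\<close>
  define p0 where "p0 = (\<lambda>x. P x - a * x $ 3)"
  have p0: "C1 p0" unfolding p0_def by (intro C1_intros C1_P)
  have dp0: "pd 3 p0 x = pd 3 P x - a" for x
    unfolding p0_def by (simp add: pd_diff pd_mult pd_coord pd_const C1_intros C1_P)
  have per0: "zperiodic L p0"
    unfolding zperiodic_def p0_def c by (simp add: algebra_simps axis_nth)
  have sup: "?p x = 0" if "\<bar>x $ 1\<bar> \<ge> ?K \<or> \<bar>x $ 2\<bar> \<ge> ?K" for x
    using cutoff_outside_box[of R ?K] that R by auto
  define S0 where "S0 = (\<lambda>x. pd 3 ?p x * p0 x + ?p x * pd 3 p0 x)"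
  have S0: "slab_int L ?K S0 = 0" unfolding S0_def
    by (rule slab_by_parts[OF p0 per0 C1_cutoff zperiodic_cutoff sup]) (use R L_pos in auto)
  \<comment> \<open>Momentum flux of the third equation: by incompressibility its divergence is
    \<open>conv 3 - lap 3\<close>.\<close>
  define F where "F = (\<lambda>i x. U i x * U 3 x - pd i (U 3) x)"
  have F: "C1 (F i)" for i unfolding F_def by (intro C1_intros C1_U C1_dU)
  have perF: "zperiodic L (F i)" for i
    using periodic_U periodic_dU by (simp add: F_def zperiodic_def)
  have dF: "pd i (F i) x = pd i (U i) x * U 3 x + U i x * pd i (U 3) x - pd i (pd i (U 3)) x" for i x
    unfolding F_def by (simp add: pd_diff pd_mult C1_U C1_dU C1_mult)
  define S1 where "S1 = (\<lambda>x. \<Sum>i\<in>UNIV. pd i ?p x * F i x + ?p x * pd i (F i) x)"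
  have cF: "continuous_on UNIV (F i)" "continuous_on UNIV (pd i (F i))" "continuous_on UNIV p0" "continuous_on UNIV (pd 3 p0)" for i
    by (intro C1_cont C1_pd_cont F p0)+
  have "slab_int L ?K S1 = (\<Sum>i\<in>UNIV. slab_int L ?K (\<lambda>x. pd i ?p x * F i x + ?p x * pd i (F i) x))"
    unfolding S1_def by (intro slab_sum finite cts cF)
  also have "\<dots> = 0"
    by (intro sum.neutral ballI slab_by_parts[OF F perF C1_cutoff zperiodic_cutoff sup]) (use R L_pos in auto)
  finally have S1: "slab_int L ?K S1 = 0" .
  have cS: "continuous_on UNIV S0" "continuous_on UNIV S1"
    unfolding S0_def S1_def by (intro cts cF)+
  have id: "a * ?p x = (\<Sum>i\<in>UNIV. pd i ?p x * F i x) - (S0 x + S1 x)" for x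
  proof -
    have "S1 x = (\<Sum>i\<in>UNIV. pd i ?p x * F i x) + ?p x * ((\<Sum>i\<in>UNIV. pd i (U i) x) * U 3 x + conv 3 x - lap 3 x)"
      by (simp add: S1_def dF conv_def lap_def sum.distrib sum_subtractf sum_distrib_left[symmetric] sum_distrib_right[symmetric])
    then show ?thesis
      by (simp add: div_free S0_def dp0 P_eq pd_cutoff algebra_simps)
  qed
  let ?w = "cutoff (2 * R)"
  \<comment> \<open>From \<open>\<bar>t\<bar> \<le> 1 + t^2\<close> for the derivative and
    \<open>M^2\<close> for the product of velocities, summed over three directions. The wider cutoff
    \<open>?w\<close> is 1 wherever the gradient of \<open>?p\<close> is nonzero.\<close>
  define G where "G = (\<lambda>x. 12 / R * ((?w x)\<^sup>2 * Q x + (3 + 3 * M\<^sup>2)))"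
  have b: "\<bar>\<Sum>i\<in>UNIV. pd i ?p x * F i x\<bar> \<le> G x" for x
  proof -
    have "\<bar>pd i ?p x * F i x\<bar> \<le> 12 / R * ((?w x)\<^sup>2 * (pd i (U 3) x)\<^sup>2 + (1 + M\<^sup>2))" for i
    proof (cases "pd i ?p x = 0")
      case False
      then have "rad2 x \<le> (2 * R)\<^sup>2"
        using pd_cutoff_nonzero(2)[OF _ False] R zero_le_power2[of R] four_x_squared[of R] by linarith
      then have w: "?w x = 1" using R by (intro cutoff_eq_1) auto
      have "0 \<le> (\<bar>pd i (U 3) x\<bar> - 1)\<^sup>2" by simp
      then have "\<bar>pd i (U 3) x\<bar> \<le> 1 + (pd i (U 3) x)\<^sup>2" 
        using abs_ge_zero[of "pd i (U 3) x"] zero_le_power2[of "pd i (U 3) x"]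
        unfolding power2_diff power2_abs by simp
      moreover have "\<bar>U i x * U 3 x\<bar> \<le> M\<^sup>2"
        unfolding abs_mult power2_eq_square using bound M_nonneg by (intro mult_mono) auto
      ultimately have "\<bar>F i x\<bar> \<le> (?w x)\<^sup>2 * (pd i (U 3) x)\<^sup>2 + (1 + M\<^sup>2)"
        unfolding F_def w by simp
      then show ?thesis unfolding abs_mult using R
        by (intro mult_mono pd_cutoff_bound) auto
    qed (use R in simp)
    then have "(\<Sum>i\<in>UNIV. \<bar>pd i ?p x * F i x\<bar>) \<le> (\<Sum>i\<in>UNIV. 12 / R * ((?w x)\<^sup>2 * (pd i (U 3) x)\<^sup>2 + (1 + M\<^sup>2)))"
      by (intro sum_mono)
    also have "\<dots> = 12 / R * ((?w x)\<^sup>2 * (\<Sum>i\<in>UNIV. (pd i (U 3) x)\<^sup>2) + (3 + 3 * M\<^sup>2))"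
      by (simp only: sum_distrib_left[symmetric] sum.distrib) simp
    also have "\<dots> \<le> G x"
      unfolding G_def Q_def using R
      by (intro mult_left_mono add_mono order_refl member_le_sum[of 3 UNIV "\<lambda>j. \<Sum>i\<in>UNIV. (pd i (U j) x)\<^sup>2"]) (auto intro: sum_nonneg)
    finally show ?thesis by (rule order_trans[OF sum_abs])
  qed
  have cG: "continuous_on UNIV G" unfolding G_def by (intro cts) (use R in auto)
  have sG: "slab_int L ?K G = 12 / R * (slab_int L ?K (\<lambda>x. (?w x)\<^sup>2 * Q x) + 64 * R\<^sup>2 * L * (3 + 3 * M\<^sup>2))"
    unfolding G_def slab_cmult using R L_pos
    by (subst slab_add; (intro cts)?) (simp add: slab_const power_mult_distrib)
  have 1: "slab_int L ?K (\<lambda>x. a * ?p x) \<le> slab_int L ?K (\<lambda>x. G x - (S0 x + S1 x))"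
    using b by (intro slab_mono cts cG cS) (auto simp: id abs_le_iff)
  have 2: "slab_int L ?K (\<lambda>x. - a * ?p x) \<le> slab_int L ?K (\<lambda>x. G x + (S0 x + S1 x))"
  proof (intro slab_mono cts cG cS)
    show "- a * ?p x \<le> G x + (S0 x + S1 x)" for x using b[of x] id[of x] by (simp add: abs_le_iff)
  qed
  have "slab_int L ?K (\<lambda>x. G x - (S0 x + S1 x)) = slab_int L ?K G"
    "slab_int L ?K (\<lambda>x. G x + (S0 x + S1 x)) = slab_int L ?K G"
    using cG cS S0 S1 by (simp_all add: slab_diff slab_add continuous_on_add)
  with 1[unfolded slab_cmult] 2[unfolded slab_cmult] have "\<bar>a\<bar> * slab_int L ?K ?p \<le> slab_int L ?K G"
    by (simp add: abs_if)
  moreover have "\<bar>a\<bar> * (R\<^sup>2 * L) \<le> \<bar>a\<bar> * slab_int L ?K ?p"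
    using R L_pos by (intro mult_left_mono slab_cutoff_ge) auto
  ultimately show ?thesis using sG by simp
qed

text \<open>With \<open>gradient_growth\<close>, \<open>pressure_slope_bound\<close> sets a left
  side of order R^2 against a right side of order R, so letting R grow excludes a nonzero
  drift.\<close>

lemma periodic_P: "zperiodic L P"
proof -
  obtain c where c: "\<And>x. P (x + L *\<^sub>R axis 3 1) = P x + c" using pressure_increment by blast
  obtain C where C: "0 \<le> C" "\<And>R K. 1 \<le> R \<Longrightarrow> 2 * R \<le> K \<Longrightarrow> slab_int L K (\<lambda>x. (cutoff R x)\<^sup>2 * Q x) \<le> C * K\<^sup>2"
    using gradient_growth by blast
  define a where "a = c / L"
  define D where "D = 12 * (16 * C + 64 * L * (3 + 3 * M\<^sup>2))"
  have *: "\<bar>a\<bar> * L * R \<le> D" if R: "1 \<le> R" for R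
  proof -
    have "\<bar>a\<bar> * (R\<^sup>2 * L) \<le> 12 / R * (slab_int L (4 * R) (\<lambda>x. (cutoff (2 * R) x)\<^sup>2 * Q x) + 64 * R\<^sup>2 * L * (3 + 3 * M\<^sup>2))"
      using L_pos by (intro pressure_slope_bound R) (simp add: c a_def)
    also have "\<dots> \<le> 12 / R * (C * (4 * R)\<^sup>2 + 64 * R\<^sup>2 * L * (3 + 3 * M\<^sup>2))"
      using R by (intro mult_left_mono add_right_mono C) auto
    also have "\<dots> = D * R" using R by (simp add: D_def power_mult_distrib power2_eq_square field_simps)
    finally have "(\<bar>a\<bar> * L * R) * R \<le> D * R" by (simp add: power2_eq_square mult_ac)
    then show ?thesis using R by simp
  qed
  have "a = 0"
  proof (rule ccontr)
    assume "a \<noteq> 0"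
    then have p: "0 < \<bar>a\<bar> * L" using L_pos by simp
    define R where "R = max 1 ((D + 1) / (\<bar>a\<bar> * L))"
    have "D + 1 = \<bar>a\<bar> * L * ((D + 1) / (\<bar>a\<bar> * L))"
      using p L_pos \<open>a \<noteq> 0\<close> by simp
    also have "\<dots> \<le> \<bar>a\<bar> * L * R" using p by (intro mult_left_mono) (auto simp: R_def)
    also have "\<dots> \<le> D" by (rule *) (simp add: R_def)
    finally show False by simp
  qed
  then show ?thesis using c L_pos by (simp add: a_def zperiodic_def)
qed

end

section \<open>Energy estimate for flows without mean radial flux\<close>

text \<open>Isolates what the energy estimate takes from helical symmetry beyond vertical
  periodicity: a zero mean on every vertical line.\<close>

locale zero_flux_flow = periodic_flow +
  assumes mean_flux: "integral {0..L} (\<lambda>z. x * U 1 (pt (x, y, z)) + y * U 2 (pt (x, y, z))) = 0"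
begin

text \<open>Radius times radial velocity. The weight keeps it smooth across the axis, and it is
  exactly what the cutoff gradient produces when paired with the velocity.\<close>

definition flux :: "real^3 \<Rightarrow> real" where
  "flux x = x $ 1 * U 1 x + x $ 2 * U 2 x"

text \<open>The Bernoulli head: paired with the velocity, its gradient accounts for convection and
  pressure together, so that \<open>u . grad head\<close> equals \<open>u . lap\<close>.\<close>

definition head :: "real^3 \<Rightarrow> real" where
  "head x = P x + 1 / 2 * (\<Sum>i\<in>UNIV. U i x * U i x)"

lemma C1_flux: "C1 flux" unfolding flux_def[abs_def] by (intro C1_intros C1_U)

lemma pd3_flux: "pd 3 flux x = x $ 1 * pd 3 (U 1) x + x $ 2 * pd 3 (U 2) x"
  unfolding flux_def[abs_def] by (simp add: pd_add pd_mult pd_coord C1_intros C1_U)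

lemma C1_head: "C1 head" unfolding head_def[abs_def] by (intro C1_intros C1_U C1_P) auto

lemma pd_head: "pd j head x = pd j P x + (\<Sum>i\<in>UNIV. U i x * pd j (U i) x)"
proof -
  have s: "C1 (\<lambda>x. \<Sum>i\<in>UNIV. U i x * U i x)" by (intro C1_intros C1_U) auto
  have "pd j (\<lambda>x. \<Sum>i\<in>UNIV. U i x * U i x) x = (\<Sum>i\<in>UNIV. pd j (\<lambda>x. U i x * U i x) x)"
    by (rule C1_sum(2)) (auto intro: C1_mult C1_U)
  also have "\<dots> = 2 * (\<Sum>i\<in>UNIV. U i x * pd j (U i) x)"
    by (simp add: pd_mult C1_U sum_distrib_left mult_ac)
  finally show ?thesis
    unfolding head_def[abs_def]
    by (subst pd_add[OF C1_P C1_mult[OF C1_const s]], subst pd_mult[OF C1_const s]) (simp add: pd_const)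
qed

lemma periodic_head: "zperiodic L head"
  using periodic_P periodic_U by (simp add: zperiodic_def head_def)

lemmas cts' = cts C1_cont[OF C1_flux] C1_pd_cont[OF C1_flux] C1_cont[OF C1_head] C1_pd_cont[OF C1_head]
  continuous_on_cutoff_slope

text \<open>The equation replaces \<open>pd 3 P\<close> by \<open>lap 3 - conv 3\<close>. The 18 is
  3 * (3 + 3), from the convection term and from the derivative of the kinetic energy.\<close>

lemma pd3_head_bound: "(pd 3 head x)\<^sup>2 \<le> 3 * (\<Sum>j\<in>UNIV. (lap j x)\<^sup>2) + 18 * M\<^sup>2 * Q x"
proof -
  define s where "s = (\<Sum>i\<in>UNIV. U i x * pd 3 (U i) x)"
  have "(pd 3 head x)\<^sup>2 = (lap 3 x + (- conv 3 x) + s)\<^sup>2" by (simp add: pd_head P_eq s_def)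
  also have "\<dots> \<le> 3 * ((lap 3 x)\<^sup>2 + (- conv 3 x)\<^sup>2 + s\<^sup>2)" by (rule square_sum3_le)
  also have "\<dots> \<le> 3 * ((\<Sum>j\<in>UNIV. (lap j x)\<^sup>2) + 3 * M\<^sup>2 * Q x + 3 * M\<^sup>2 * Q x)"
  proof (intro mult_left_mono add_mono)
    show "(lap 3 x)\<^sup>2 \<le> (\<Sum>j\<in>UNIV. (lap j x)\<^sup>2)" by (rule member_le_sum) auto
    have "(conv 3 x)\<^sup>2 \<le> (\<Sum>j\<in>UNIV. (conv j x)\<^sup>2)" by (rule member_le_sum) auto
    then show "(- conv 3 x)\<^sup>2 \<le> 3 * M\<^sup>2 * Q x" using conv_sum_bound[of x] by simp
    have "s\<^sup>2 \<le> 3 * (\<Sum>i\<in>UNIV. (U i x * pd 3 (U i) x)\<^sup>2)" unfolding s_def by (rule sum3_square_le)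
    also have "\<dots> \<le> 3 * (\<Sum>i\<in>UNIV. M\<^sup>2 * (\<Sum>k\<in>UNIV. (pd k (U i) x)\<^sup>2))"
    proof (intro mult_left_mono sum_mono)
      show "(U i x * pd 3 (U i) x)\<^sup>2 \<le> M\<^sup>2 * (\<Sum>k\<in>UNIV. (pd k (U i) x)\<^sup>2)" for i
        unfolding power_mult_distrib
        by (intro mult_mono U_square_le member_le_sum[of 3 UNIV "\<lambda>k. (pd k (U i) x)\<^sup>2"]) auto
    qed auto
    also have "\<dots> = 3 * M\<^sup>2 * Q x" by (simp add: Q_def sum_distrib_left[symmetric])
    finally show "s\<^sup>2 \<le> 3 * M\<^sup>2 * Q x" .
  qed auto
  finally show ?thesis by (simp add: mult_ac)
qed

text \<open>The weights \<open>x $ 1\<close> and \<open>x $ 2\<close> do not vary with height, so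
  this is Cauchy-Schwarz in the horizontal plane.\<close>

lemma pd3_flux_bound: "(pd 3 flux x)\<^sup>2 \<le> rad2 x * Q x"
proof -
  have "0 \<le> (x $ 1 * pd 3 (U 2) x - x $ 2 * pd 3 (U 1) x)\<^sup>2" by simp
  then have "(pd 3 flux x)\<^sup>2 \<le> rad2 x * ((pd 3 (U 1) x)\<^sup>2 + (pd 3 (U 2) x)\<^sup>2)"
    by (simp add: pd3_flux rad2_def power2_eq_square algebra_simps)
  also have "\<dots> \<le> rad2 x * Q x"
    by (intro mult_left_mono rad2_nonneg) (simp add: Q_def sum_3)
  finally show ?thesis .
qed

text \<open>\<open>cutoff_slope\<close> depends on the radius only. It is constant along each
  vertical line, and \<open>poincare_product\<close> applies line by line.\<close>

lemma slab_poincare: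
  assumes e: "0 < e"
  shows "slab_int L K (\<lambda>x. cutoff_slope R x * (head x * flux x))
    \<le> slab_int L K (\<lambda>x. L\<^sup>2 * (\<bar>cutoff_slope R x\<bar> * (e * (pd 3 head x)\<^sup>2 + (pd 3 flux x)\<^sup>2 / e)))"
proof -
  let ?f = "\<lambda>x. L\<^sup>2 * (\<bar>cutoff_slope R x\<bar> * (e * (pd 3 head x)\<^sup>2 + (pd 3 flux x)\<^sup>2 / e))"
  let ?g = "\<lambda>x. cutoff_slope R x * (head x * flux x)"
  have cf: "continuous_on UNIV ?f" using e by (intro cts') auto
  have cg: "continuous_on UNIV ?g" by (intro cts')
  note c = cf cg
  have "0 \<le> slab_int L K (\<lambda>x. ?f x - ?g x)"
  proof (rule slab_vertical_nonneg)
    show "continuous_on UNIV (\<lambda>x. ?f x - ?g x)" by (intro continuous_on_diff c)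
  next
    fix x y :: real
    define k where "k = cutoff_slope R (pt (x, y, 0))"
    define a b where "a = (\<lambda>z. head (pt (x, y, z)))" and "b = (\<lambda>z. flux (pt (x, y, z)))"
    define a' b' where "a' = (\<lambda>z. pd 3 head (pt (x, y, z)))" and "b' = (\<lambda>z. pd 3 flux (pt (x, y, z)))"
    have k: "cutoff_slope R (pt (x, y, z)) = k" for z by (simp add: k_def cutoff_slope_def rad2_def)
    have ca: "continuous_on S a" "continuous_on S b" "continuous_on S a'" "continuous_on S b'" for S
      unfolding a_def b_def a'_def b'_def
      by (rule continuous_on_comp_pt[OF C1_cont[OF C1_head]] continuous_on_comp_pt[OF C1_cont[OF C1_flux]]
          continuous_on_comp_pt[OF C1_pd_cont[OF C1_head]] continuous_on_comp_pt[OF C1_pd_cont[OF C1_flux]],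
          intro continuous_intros)+
    have "\<bar>integral {0..L} (\<lambda>t. a t * b t)\<bar>
        \<le> L\<^sup>2 * (e * integral {0..L} (\<lambda>t. (a' t)\<^sup>2) + integral {0..L} (\<lambda>t. (b' t)\<^sup>2) / e)"
    proof (rule poincare_product[OF L_pos e _ ca(3) _ ca(4)])
      show "(a has_real_derivative a' t) (at t)" for t
        unfolding a_def a'_def by (rule C1_pt_derivs(3)[OF C1_head])
      show "(b has_real_derivative b' t) (at t)" for t
        unfolding b_def b'_def by (rule C1_pt_derivs(3)[OF C1_flux])
      show "integral {0..L} b = 0" using mean_flux[of x y] by (simp add: b_def flux_def)
    qed
    then have "\<bar>k\<bar> * \<bar>integral {0..L} (\<lambda>t. a t * b t)\<bar>
        \<le> \<bar>k\<bar> * (L\<^sup>2 * (e * integral {0..L} (\<lambda>t. (a' t)\<^sup>2) + integral {0..L} (\<lambda>t. (b' t)\<^sup>2) / e))"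
      by (rule mult_left_mono) simp
    then have 1: "k * integral {0..L} (\<lambda>t. a t * b t)
        \<le> L\<^sup>2 * \<bar>k\<bar> * (e * integral {0..L} (\<lambda>t. (a' t)\<^sup>2) + integral {0..L} (\<lambda>t. (b' t)\<^sup>2) / e)"
      unfolding abs_mult[symmetric] by (simp add: mult_ac abs_le_iff)
    have "integral {0..L} (\<lambda>z. ?f (pt (x, y, z)) - ?g (pt (x, y, z)))
      = integral {0..L} (\<lambda>z. L\<^sup>2 * \<bar>k\<bar> * (e * (a' z)\<^sup>2 + (b' z)\<^sup>2 / e) - k * (a z * b z))"
      by (simp add: k a_def b_def a'_def b'_def mult_ac)
    also have "\<dots> = integral {0..L} (\<lambda>z. L\<^sup>2 * \<bar>k\<bar> * (e * (a' z)\<^sup>2 + (b' z)\<^sup>2 / e)) - integral {0..L} (\<lambda>z. k * (a z * b z))"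
      using e by (intro integral_diff integrable_continuous_real continuous_intros ca) auto
    also have "integral {0..L} (\<lambda>z. L\<^sup>2 * \<bar>k\<bar> * (e * (a' z)\<^sup>2 + (b' z)\<^sup>2 / e))
      = L\<^sup>2 * \<bar>k\<bar> * integral {0..L} (\<lambda>z. e * (a' z)\<^sup>2 + (b' z)\<^sup>2 / e)" by (rule integral_mult_right)
    also have "integral {0..L} (\<lambda>z. e * (a' z)\<^sup>2 + (b' z)\<^sup>2 / e)
      = e * integral {0..L} (\<lambda>t. (a' t)\<^sup>2) + integral {0..L} (\<lambda>t. (b' t)\<^sup>2) / e"
      using e by (subst integral_add) (auto intro!: integrable_continuous_real continuous_intros ca)
    also have "integral {0..L} (\<lambda>z. k * (a z * b z)) = k * integral {0..L} (\<lambda>t. a t * b t)" by (rule integral_mult_right)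
    finally show "0 \<le> integral {0..L} (\<lambda>z. ?f (pt (x, y, z)) - ?g (pt (x, y, z)))" using 1 by simp
  qed
  then show ?thesis using c by (simp add: slab_diff)
qed

text \<open>The equation tested with the cutoff times the velocity. \<open>S1\<close> integrates the
  viscous term by parts, \<open>S2\<close> the transport of the head; since the cutoff gradient is
  horizontal and radial, the head survives only against \<open>flux\<close>.\<close>

lemma energy_identity:
  assumes R: "0 < R" and K: "2 * R \<le> K"
  shows "slab_int L K (\<lambda>x. cutoff R x * Q x)
    = slab_int L K (\<lambda>x. cutoff_slope R x * (head x * flux x))
      - slab_int L K (\<lambda>x. \<Sum>j\<in>UNIV. \<Sum>i\<in>UNIV. pd i (cutoff R) x * (U j x * pd i (U j) x))"
proof -
  let ?p = "cutoff R"
  have sup: "?p x = 0" if "\<bar>x $ 1\<bar> \<ge> K \<or> \<bar>x $ 2\<bar> \<ge> K" for x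
    using cutoff_outside_box[OF R K that] .
  define F where "F = (\<lambda>i j x. U j x * pd i (U j) x)"
  have F: "C1 (F i j)" for i j unfolding F_def by (intro C1_intros C1_U C1_dU)
  have dF: "pd i (F i j) x = pd i (U j) x * pd i (U j) x + U j x * pd i (pd i (U j)) x" for i j x
    unfolding F_def by (rule pd_mult[OF C1_U C1_dU])
  define G where "G = (\<lambda>j x. head x * U j x)"
  have G: "C1 (G j)" for j unfolding G_def by (intro C1_intros C1_U C1_head)
  have dG: "pd j (G j) x = pd j head x * U j x + head x * pd j (U j) x" for j x
    unfolding G_def by (rule pd_mult[OF C1_head C1_U])
  have perF: "zperiodic L (F i j)" for i j using periodic_U periodic_dU by (simp add: F_def zperiodic_def)
  have perG: "zperiodic L (G j)" for j using periodic_U periodic_head by (simp add: G_def zperiodic_def)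
  note c = cts' C1_pd_cont[OF F] C1_cont[OF F] C1_pd_cont[OF G] C1_cont[OF G]
  define S1 where "S1 = (\<lambda>x. \<Sum>j\<in>UNIV. \<Sum>i\<in>UNIV. pd i ?p x * F i j x + ?p x * pd i (F i j) x)"
  define S2 where "S2 = (\<lambda>x. \<Sum>j\<in>UNIV. pd j ?p x * G j x + ?p x * pd j (G j) x)"
  have cS: "continuous_on UNIV S1" "continuous_on UNIV S2" unfolding S1_def S2_def by (intro c)+
  have "slab_int L K (\<lambda>x. pd i ?p x * F i j x + ?p x * pd i (F i j) x) = 0" for i j
    by (rule slab_by_parts[OF F perF C1_cutoff zperiodic_cutoff sup]) (use R K L_pos in auto)
  then have S1: "slab_int L K S1 = 0"
    unfolding S1_def by (subst slab_sum2) (intro c, simp)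
  have "slab_int L K (\<lambda>x. pd j ?p x * G j x + ?p x * pd j (G j) x) = 0" for j
    by (rule slab_by_parts[OF G perG C1_cutoff zperiodic_cutoff sup]) (use R K L_pos in auto)
  then have S2: "slab_int L K S2 = 0"
    unfolding S2_def by (subst slab_sum) (auto intro!: c)
  define T where "T = (\<lambda>x. \<Sum>j\<in>UNIV. \<Sum>i\<in>UNIV. pd i ?p x * (U j x * pd i (U j) x))"
  have cT: "continuous_on UNIV T" unfolding T_def by (intro c)
  have "?p x * Q x = (cutoff_slope R x * (head x * flux x) - T x) + (S1 x - S2 x)" for x
  proof -
    have 1: "S1 x = T x + ?p x * Q x + ?p x * (\<Sum>j\<in>UNIV. U j x * lap j x)"
      unfolding S1_def dF
      by (simp add: T_def F_def Q_def lap_def sum.distrib distrib_left sum_distrib_left[symmetric] power2_eq_square)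
    have "S2 x = (\<Sum>j\<in>UNIV. pd j ?p x * G j x) + ?p x * (\<Sum>j\<in>UNIV. pd j head x * U j x) + ?p x * head x * (\<Sum>j\<in>UNIV. pd j (U j) x)"
      by (simp add: S2_def dG sum.distrib distrib_left sum_distrib_left[symmetric] mult.assoc)
    moreover have "(\<Sum>j\<in>UNIV. pd j head x * U j x) = (\<Sum>j\<in>UNIV. U j x * lap j x)"
      by (simp add: pd_head P_eq conv_def sum_3 algebra_simps)
    moreover have "(\<Sum>j\<in>UNIV. pd j ?p x * G j x) = cutoff_slope R x * (head x * flux x)"
      by (simp add: pd_cutoff sum_3 G_def flux_def algebra_simps)
    ultimately show ?thesis using 1 by (simp add: div_free)
  qed
  then have "slab_int L K (\<lambda>x. ?p x * Q x) = slab_int L K (\<lambda>x. (cutoff_slope R x * (head x * flux x) - T x) + (S1 x - S2 x))"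
    by simp
  also have "\<dots> = slab_int L K (\<lambda>x. cutoff_slope R x * (head x * flux x)) - slab_int L K T"
    by (subst slab_add slab_diff; (intro c cS cT)?)+ (simp add: S1 S2)
  finally show ?thesis by (simp add: T_def)
qed

section \<open>The localized energy and its differences over shells\<close>

definition energy :: "real \<Rightarrow> real" where
  "energy R = slab_int L (2 * R) (\<lambda>x. cutoff R x * Q x)"

lemma energy_eq:
  assumes "0 < R" "2 * R \<le> K"
  shows "slab_int L K (\<lambda>x. cutoff R x * Q x) = energy R"
  unfolding energy_def using assms cutoff_outside_box[of R "2 * R"]
  by (intro slab_enlarge cts) auto

lemma energy_nonneg: "0 \<le> energy R"
  unfolding energy_def by (intro slab_nonneg cts) (simp add: cutoff_bounds Q_nonneg)

lemma energy_mono: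
  assumes "0 < R" "2 * R \<le> S"
  shows "energy R \<le> energy S"
proof -
  have "2 * R\<^sup>2 \<le> (2 * R)\<^sup>2" by (simp add: power_mult_distrib)
  also have "\<dots> \<le> S\<^sup>2" using assms by (intro power_mono) auto
  finally have *: "cutoff R x \<le> cutoff S x" for x using assms by (intro cutoff_mono) auto
  have "energy R = slab_int L (2 * S) (\<lambda>x. cutoff R x * Q x)" using assms by (intro energy_eq[symmetric]) auto
  also have "\<dots> \<le> energy S" unfolding energy_def
    using * Q_nonneg by (intro slab_mono cts mult_right_mono)
  finally show ?thesis .
qed

text \<open>\<open>gradient_growth\<close> carries the square of a cutoff. The cutoff at radius 2 R
  is 1 on the support of the one at R, so its square dominates; 16 is (4 R)^2 / R^2.\<close>

lemma energy_growth: "\<exists>C\<ge>0. \<forall>R\<ge>1. energy R \<le> C * R\<^sup>2"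
proof -
  obtain C where C: "0 \<le> C" "\<And>R K. 1 \<le> R \<Longrightarrow> 2 * R \<le> K \<Longrightarrow> slab_int L K (\<lambda>x. (cutoff R x)\<^sup>2 * Q x) \<le> C * K\<^sup>2"
    using gradient_growth by blast
  have "energy R \<le> (16 * C) * R\<^sup>2" if R: "1 \<le> R" for R
  proof -
    have "energy R = slab_int L (4 * R) (\<lambda>x. cutoff R x * Q x)" using R by (intro energy_eq[symmetric]) auto
    also have "\<dots> \<le> slab_int L (4 * R) (\<lambda>x. (cutoff (2 * R) x)\<^sup>2 * Q x)"
    proof (intro slab_mono cts mult_right_mono Q_nonneg)
      show "cutoff R x \<le> (cutoff (2 * R) x)\<^sup>2" for x
      proof (cases "2 * R\<^sup>2 \<le> rad2 x")
        case True
        then show ?thesis using R by (simp add: cutoff_eq_0)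
      next
        case False
        then have "rad2 x \<le> (2 * R)\<^sup>2" using zero_le_power2[of R] four_x_squared[of R] by linarith
        then show ?thesis using R cutoff_bounds by (simp add: cutoff_eq_1)
      qed
    qed
    also have "\<dots> \<le> C * (4 * R)\<^sup>2" using R by (intro C) auto
    finally show ?thesis by (simp add: power_mult_distrib)
  qed
  then show ?thesis using C(1) by (intro exI[of _ "16 * C"]) auto
qed

text \<open>A difference of two cutoffs, so that its integral against \<open>Q\<close> is an energy
  difference. It equals 1 on the annulus that carries the gradient of
  \<open>cutoff R\<close>.\<close>

definition shell :: "real \<Rightarrow> real^3 \<Rightarrow> real" where
  "shell R x = cutoff (2 * R) x - cutoff (R / 2) x"

lemma shell_nonneg:
  assumes "0 < R"
  shows "0 \<le> shell R x"
  unfolding shell_def using cutoff_mono[of "R / 2" "2 * R" x] assms by (simp add: power_divide power_mult_distrib)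

lemma shell_eq_1:
  assumes "0 < R" "R\<^sup>2 \<le> rad2 x" "rad2 x \<le> 2 * R\<^sup>2"
  shows "shell R x = 1" "cutoff (2 * R) x = 1"
proof -
  show 1: "cutoff (2 * R) x = 1"
    using assms zero_le_power2[of R] by (intro cutoff_eq_1) (auto simp: power_mult_distrib simp del: zero_le_power2)
  have "cutoff (R / 2) x = 0"
    using assms zero_le_power2[of R] by (intro cutoff_eq_0) (auto simp: power_divide simp del: zero_le_power2)
  with 1 show "shell R x = 1" by (simp add: shell_def)
qed

lemma continuous_shell: "continuous_on UNIV (shell R)"
  unfolding shell_def[abs_def] by (intro cts)

lemma slab_shell:
  assumes "0 < R"
  shows "slab_int L (4 * R) (\<lambda>x. shell R x * Q x) = energy (2 * R) - energy (R / 2)"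
  using assms energy_eq[of "2 * R" "4 * R"] energy_eq[of "R / 2" "4 * R"]
  by (simp add: shell_def left_diff_distrib slab_diff cts)

text \<open>Both the radial flux and the head pressure are controlled in \<open>L\<^sup>2\<close> of the shell by their vertical
  derivatives. This gains a factor of \<open>R\<close> over the trivial bound.\<close>

lemma head_flux_estimate:
  "\<exists>C\<ge>0. \<forall>R\<ge>1. \<forall>e>0. slab_int L (4 * R) (\<lambda>x. cutoff_slope R x * (head x * flux x))
    \<le> C * (e + (energy (2 * R) - energy (R / 2)) / e)"
proof -
  obtain C where C: "0 \<le> C" "\<And>R K. 1 \<le> R \<Longrightarrow> 2 * R \<le> K \<Longrightarrow> slab_int L K (\<lambda>x. (cutoff R x)\<^sup>2 * Q x) \<le> C * K\<^sup>2"
     "\<And>R K. 1 \<le> R \<Longrightarrow> 2 * R \<le> K \<Longrightarrow> slab_int L K (\<lambda>x. cutoff R x ^ 4 * (\<Sum>j\<in>UNIV. (lap j x)\<^sup>2)) \<le> C * K\<^sup>2"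
    using gradient_growth by blast
  \<comment> \<open>In \<open>c1\<close> the slope bound 8 / R^2 meets the bound C * (4 R)^2 of
    \<open>gradient_growth\<close>; in \<open>c2\<close> it meets the factor 2 R^2 of
    \<open>pd3_flux_bound\<close>. Both constants are free of R.\<close>
  define c1 where "c1 = L\<^sup>2 * (8 * (3 + 18 * M\<^sup>2) * (16 * C))"
  define c2 where "c2 = L\<^sup>2 * 16"
  have nn: "0 \<le> c1" "0 \<le> c2" using C(1) by (simp_all add: c1_def c2_def)
  have "slab_int L (4 * R) (\<lambda>x. cutoff_slope R x * (head x * flux x))
    \<le> (c1 + c2) * (e + (energy (2 * R) - energy (R / 2)) / e)" if R: "1 \<le> R" and e: "0 < e" for R e
  proof -
    let ?w = "cutoff (2 * R)"
    let ?A = "\<lambda>x. ?w x ^ 4 * (\<Sum>j\<in>UNIV. (lap j x)\<^sup>2)" and ?B = "\<lambda>x. (?w x)\<^sup>2 * Q x"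
    let ?D = "energy (2 * R) - energy (R / 2)"
    have pw: "L\<^sup>2 * (\<bar>cutoff_slope R x\<bar> * (e * (pd 3 head x)\<^sup>2 + (pd 3 flux x)\<^sup>2 / e))
      \<le> L\<^sup>2 * (e * (8 / R\<^sup>2) * (3 * ?A x + 18 * M\<^sup>2 * ?B x) + 16 / e * (shell R x * Q x))" for x
    proof (cases "cutoff_slope R x = 0")
      case True
      then show ?thesis using e shell_nonneg[of R x] R Q_nonneg[of x]
        by (auto intro!: mult_nonneg_nonneg add_nonneg_nonneg divide_nonneg_nonneg sum_nonneg)
    next
      case False
      note r = cutoff_slope_nonzero[OF _ False]
      have w: "?w x = 1" "shell R x = 1" using r R shell_eq_1 by auto
      have "\<bar>cutoff_slope R x\<bar> * (e * (pd 3 head x)\<^sup>2 + (pd 3 flux x)\<^sup>2 / e)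
        \<le> 8 / R\<^sup>2 * (e * (3 * ?A x + 18 * M\<^sup>2 * ?B x) + (2 * R\<^sup>2 * Q x) / e)"
      proof (intro mult_mono add_mono mult_left_mono divide_right_mono cutoff_slope_bound)
        show "(pd 3 head x)\<^sup>2 \<le> 3 * ?A x + 18 * M\<^sup>2 * ?B x" using pd3_head_bound[of x] by (simp add: w)
        have "rad2 x * Q x \<le> (2 * R\<^sup>2) * Q x" using r R Q_nonneg by (intro mult_right_mono) auto
        then show "(pd 3 flux x)\<^sup>2 \<le> 2 * R\<^sup>2 * Q x" using pd3_flux_bound[of x] by linarith
      qed (use e R in auto)
      also have "\<dots> = e * (8 / R\<^sup>2) * (3 * ?A x + 18 * M\<^sup>2 * ?B x) + 16 / e * (shell R x * Q x)"
        using R e by (simp add: w field_simps)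
      finally show ?thesis by (rule mult_left_mono) simp
    qed
    have "slab_int L (4 * R) (\<lambda>x. cutoff_slope R x * (head x * flux x))
      \<le> slab_int L (4 * R) (\<lambda>x. L\<^sup>2 * (\<bar>cutoff_slope R x\<bar> * (e * (pd 3 head x)\<^sup>2 + (pd 3 flux x)\<^sup>2 / e)))"
      by (rule slab_poincare[OF e])
    also have "\<dots> \<le> slab_int L (4 * R) (\<lambda>x. L\<^sup>2 * (e * (8 / R\<^sup>2) * (3 * ?A x + 18 * M\<^sup>2 * ?B x) + 16 / e * (shell R x * Q x)))"
      using e R by (intro slab_mono pw cts' continuous_shell) auto
    also have "\<dots> = L\<^sup>2 * (e * (8 / R\<^sup>2) * (3 * slab_int L (4 * R) ?A + 18 * M\<^sup>2 * slab_int L (4 * R) ?B) + 16 / e * ?D)"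
      unfolding slab_cmult
      using R
      by (subst slab_add) (intro cts' continuous_shell, intro cts' continuous_shell, simp only: slab_cmult slab_shell,
          subst slab_add, intro cts', intro cts', simp only: slab_cmult slab_shell)
    also have "\<dots> \<le> L\<^sup>2 * (e * (8 / R\<^sup>2) * (3 * (C * (4 * R)\<^sup>2) + 18 * M\<^sup>2 * (C * (4 * R)\<^sup>2)) + 16 / e * ?D)"
      using R e by (intro mult_left_mono add_mono C order_refl) auto
    also have "\<dots> = c1 * e + c2 * (?D / e)"
      using R e by (simp add: c1_def c2_def power_mult_distrib field_simps)
    also have "\<dots> \<le> (c1 + c2) * (e + ?D / e)"
    proof -
      have "0 \<le> ?D / e" using energy_mono[of "R / 2" "2 * R"] R e by simp
      then have "0 \<le> c1 * (?D / e)" "0 \<le> c2 * e" using nn e by (auto simp del: times_divide_eq_right intro: mult_nonneg_nonneg)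
      then show ?thesis unfolding distrib_left distrib_right by linarith
    qed
    finally show ?thesis .
  qed
  then show ?thesis using nn by (intro exI[of _ "c1 + c2"]) auto
qed

text \<open>The viscous cutoff term scales like the head term: by Young's inequality it costs
  \<open>e * (12 * M / R)^2\<close> on a volume of order R^2, plus shell energy over
  \<open>e\<close>.\<close>

lemma energy_inequality:
  "\<exists>C\<ge>0. \<forall>R\<ge>1. \<forall>e>0. energy R \<le> C * (e + (energy (2 * R) - energy (R / 2)) / e)"
proof -
  obtain C where C: "0 \<le> C" "\<And>R e. 1 \<le> R \<Longrightarrow> 0 < e \<Longrightarrow> slab_int L (4 * R) (\<lambda>x. cutoff_slope R x * (head x * flux x))
    \<le> C * (e + (energy (2 * R) - energy (R / 2)) / e)" using head_flux_estimate by blast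
  \<comment> \<open>9 counts the index pairs and \<open>64 * L\<close> is the slab volume for
    \<open>K = 4 * R\<close> divided by R^2; the summand 1 covers the coefficient of the shell
    energy.\<close>
  define C' where "C' = 1 + 9 * (12 * M)\<^sup>2 * 64 * L"
  have C': "1 \<le> C'" "9 * (12 * M)\<^sup>2 * 64 * L \<le> C'" using L_pos by (simp_all add: C'_def)
  have "energy R \<le> (C + C') * (e + (energy (2 * R) - energy (R / 2)) / e)" if R: "1 \<le> R" and e: "0 < e" for R e
  proof -
    let ?D = "energy (2 * R) - energy (R / 2)"
    define T where "T = (\<lambda>x. \<Sum>j\<in>UNIV. \<Sum>i\<in>UNIV. pd i (cutoff R) x * (U j x * pd i (U j) x))"
    have cT: "continuous_on UNIV T" unfolding T_def by (intro cts)
    have t: "- (pd i (cutoff R) x * (U j x * pd i (U j) x)) \<le> e * (12 * M / R)\<^sup>2 + 1 / e * (shell R x * (pd i (U j) x)\<^sup>2)" for i j x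
    proof (cases "pd i (cutoff R) x = 0")
      case True
      then show ?thesis using e R shell_nonneg[of R x] by simp
    next
      case False
      have w: "shell R x = 1" using pd_cutoff_nonzero[OF _ False] R shell_eq_1 by auto
      have "\<bar>pd i (cutoff R) x * U j x\<bar> \<le> 12 / R * M"
        unfolding abs_mult using R bound by (intro mult_mono pd_cutoff_bound) auto
      then have b: "(- (pd i (cutoff R) x * U j x))\<^sup>2 \<le> (12 * M / R)\<^sup>2"
        using power_mono[of "\<bar>pd i (cutoff R) x * U j x\<bar>" "12 * M / R" 2] by simp
      have "- (pd i (cutoff R) x * U j x) * pd i (U j) x \<le> e * (- (pd i (cutoff R) x * U j x))\<^sup>2 + (pd i (U j) x)\<^sup>2 / (4 * e)"
        by (rule young[OF e])
      also have "\<dots> \<le> e * (12 * M / R)\<^sup>2 + (pd i (U j) x)\<^sup>2 / (1 * e)"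
        using e b by (intro add_mono mult_left_mono divide_left_mono mult_right_mono) auto
      finally show ?thesis by (simp add: w mult.assoc)
    qed
    have "- T x \<le> 9 * (e * (12 * M / R)\<^sup>2) + 1 / e * (shell R x * Q x)" for x
    proof -
      have "- T x = (\<Sum>j\<in>UNIV. \<Sum>i\<in>UNIV. - (pd i (cutoff R) x * (U j x * pd i (U j) x)))" by (simp add: T_def sum_negf)
      also have "\<dots> \<le> (\<Sum>j\<in>UNIV. \<Sum>i\<in>UNIV. e * (12 * M / R)\<^sup>2 + 1 / e * (shell R x * (pd i (U j) x)\<^sup>2))"
        by (intro sum_mono t)
      also have "\<dots> = 9 * (e * (12 * M / R)\<^sup>2) + 1 / e * (shell R x * Q x)"
        by (simp only: sum.distrib sum_distrib_left[symmetric] Q_def) simp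
      finally show ?thesis .
    qed
    then have "slab_int L (4 * R) (\<lambda>x. - 1 * T x) \<le> slab_int L (4 * R) (\<lambda>x. 9 * (e * (12 * M / R)\<^sup>2) + 1 / e * (shell R x * Q x))"
      by (intro slab_mono cts cT continuous_shell) auto
    also have "\<dots> = 64 * R\<^sup>2 * L * (9 * (e * (12 * M / R)\<^sup>2)) + 1 / e * ?D"
      using R L_pos
      by (subst slab_add) (intro cts continuous_shell, intro cts continuous_shell, simp add: slab_const slab_cmult[of _ _ "1 / e"] slab_shell power_mult_distrib del: times_divide_eq_left)
    also have "\<dots> = (9 * (12 * M)\<^sup>2 * 64 * L) * e + ?D / e"
      using R by (simp add: power_divide)
    finally have T: "- slab_int L (4 * R) T \<le> (9 * (12 * M)\<^sup>2 * 64 * L) * e + ?D / e" by (simp only: slab_cmult)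
    have "energy R = slab_int L (4 * R) (\<lambda>x. cutoff R x * Q x)" using R by (intro energy_eq[symmetric]) auto
    also have "\<dots> = slab_int L (4 * R) (\<lambda>x. cutoff_slope R x * (head x * flux x)) - slab_int L (4 * R) T"
      unfolding T_def using R by (intro energy_identity) auto
    also have "\<dots> \<le> C * (e + ?D / e) + ((9 * (12 * M)\<^sup>2 * 64 * L) * e + ?D / e)"
      using C(2)[OF R e] T by linarith
    also have "\<dots> \<le> C * (e + ?D / e) + C' * (e + ?D / e)"
    proof -
      have "0 \<le> ?D / e" using energy_mono[of "R / 2" "2 * R"] R e by simp
      then have "(9 * (12 * M)\<^sup>2 * 64 * L) * e \<le> C' * e" "1 * (?D / e) \<le> C' * (?D / e)" using C' e
        by (intro mult_right_mono; simp)+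
      then show ?thesis unfolding distrib_left by linarith
    qed
    finally show ?thesis by (simp only: distrib_right)
  qed
  then show ?thesis using C(1) C' by (intro exI[of _ "C + C'"]) auto
qed

end

section \<open>Liouville theorem\<close>

text \<open>A discrete analogue of y' >= y^2 / C. A positive term forces increments bounded below,
  so the sequence passes \<open>16 * C\<close>; from there \<open>b^2 / C\<close> is at least
  \<open>16 * b\<close>, and each step multiplies by at least 17, faster than \<open>16 ^ k\<close>
  allows.\<close>

lemma quadratic_growth_recursion:
  fixes b :: "nat \<Rightarrow> real"
  assumes nn: "\<And>k. 0 \<le> b k" and C: "0 \<le> C"
    and rec: "\<And>k. (b k)\<^sup>2 \<le> C * (b (Suc k) - b k)" and ub: "\<And>k. b k \<le> C * 16 ^ k"
  shows "b m = 0"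
proof (rule ccontr)
  assume "b m \<noteq> 0"
  then have bm: "0 < b m" using nn[of m] by simp
  have C0: "C > 0"
  proof (rule ccontr)
    assume "\<not> C > 0"
    then have "C = 0" using C by simp
    then show False using rec[of m] bm by simp
  qed
  have step: "b k + (b k)\<^sup>2 / C \<le> b (Suc k)" for k using rec[of k] C0 by (simp add: field_simps)
  have lin: "b m + real n * ((b m)\<^sup>2 / C) \<le> b (m + n)" for n
  proof (induction n)
    case (Suc n)
    have "0 \<le> real n * ((b m)\<^sup>2 / C)" using C0 by simp
    then have "b m \<le> b (m + n)" using Suc by linarith
    then have "(b m)\<^sup>2 / C \<le> (b (m + n))\<^sup>2 / C" using bm C0 by (intro divide_right_mono power_mono) auto
    then show ?case using Suc step[of "m + n"]
      unfolding of_nat_Suc distrib_right add_Suc_right mult_1 by linarith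
  qed simp
  obtain n where n: "16 * C < real n * ((b m)\<^sup>2 / C)"
    using reals_Archimedean3[of "(b m)\<^sup>2 / C"] bm C0 by auto
  define N where "N = m + n"
  have N: "16 * C \<le> b N" using lin[of n] n bm unfolding N_def by linarith
  have geo: "17 ^ j * (16 * C) \<le> b (N + j)" for j
  proof (induction j)
    case (Suc j)
    have "1 * (16 * C) \<le> 17 ^ j * (16 * C)" using C0 by (intro mult_right_mono one_le_power) auto
    then have ge: "16 * C \<le> b (N + j)" using Suc by linarith
    then have "b (N + j) * (16 * C) \<le> (b (N + j))\<^sup>2" 
      unfolding power2_eq_square by (intro mult_left_mono nn)
    then have "16 * b (N + j) \<le> (b (N + j))\<^sup>2 / C" using C0 by (simp add: le_divide_eq mult_ac)
    then show ?case using step[of "N + j"] Suc by simp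
  qed (use N in simp)
  \<comment> \<open>So many steps that the ratio 17/16 outweighs the head start
    \<open>16 ^ N\<close> of the upper bound.\<close>
  obtain j where j: "16 ^ N < (17 / 16 :: real) ^ j" using real_arch_pow[of "17 / 16"] by auto
  have "17 ^ j * (16 * C) \<le> C * 16 ^ (N + j)" using geo[of j] ub[of "N + j"] by linarith
  then have "C * (17 ^ j * 16) \<le> C * (16 ^ N * 16 ^ j)" by (simp add: power_add mult_ac)
  then have "17 ^ j * 16 \<le> (16 ^ N * 16 ^ j :: real)" using C0 by simp
  moreover have "16 ^ N * 16 ^ j < (17 ^ j :: real)" using j by (simp add: power_divide field_simps)
  moreover have "0 < (17::real) ^ j" by simp
  ultimately show False by linarith
qed

context zero_flux_flow
begin

text \<open>Radii are powers of 4 because the inequality at radius 2 * 4^k compares the energies at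
  4^k and 4^(k+1); quadratic growth in the radius becomes \<open>16 ^ k\<close>.\<close>

lemma energy_eq_0: "energy (4 ^ m) = 0"
proof -
  obtain C where C: "0 \<le> C" "\<And>R e. 1 \<le> R \<Longrightarrow> 0 < e \<Longrightarrow> energy R \<le> C * (e + (energy (2 * R) - energy (R / 2)) / e)"
    using energy_inequality by blast
  obtain C' where C': "0 \<le> C'" "\<And>R. 1 \<le> R \<Longrightarrow> energy R \<le> C' * R\<^sup>2"
    using energy_growth by blast
  define K where "K = C' + 4 * C\<^sup>2"
  have K: "0 \<le> K" "C' \<le> K" "4 * C\<^sup>2 \<le> K" using C' by (simp_all add: K_def)
  let ?b = "\<lambda>k. energy (4 ^ k)"
  have rec: "(?b k)\<^sup>2 \<le> K * (?b (Suc k) - ?b k)" for k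
  proof (cases "?b k = 0")
    case True
    then show ?thesis using K energy_nonneg[of "4 ^ Suc k"] by simp
  next
    case False
    then have bp: "0 < ?b k" using energy_nonneg[of "4 ^ k"] by simp
    let ?D = "?b (Suc k) - ?b k"
    have D: "0 \<le> ?D" using energy_mono[of "4 ^ k" "4 ^ Suc k"] by simp
    have ineq: "?b k \<le> C * (e + ?D / e)" if "0 < e" for e
    proof -
      have "1 \<le> 2 * (4::real) ^ k" using one_le_power[of "4::real" k] by linarith
      from C(2)[OF this that] have "energy (2 * 4 ^ k) \<le> C * (e + ?D / e)" by simp
      moreover have "?b k \<le> energy (2 * 4 ^ k)" by (rule energy_mono) auto
      ultimately show ?thesis by linarith
    qed
    have Cp: "0 < C" using ineq[of 1] bp C(1) by (cases "C = 0") auto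
    \<comment> \<open>With \<open>e = ?b k / (2 * C)\<close> the term \<open>C * e\<close> is half
      of the left side; clearing denominators leaves the constant \<open>4 * C^2\<close>.\<close>
    have "?b k \<le> C * (?b k / (2 * C) + ?D / (?b k / (2 * C)))" using bp Cp by (intro ineq) simp
    also have "\<dots> = ?b k / 2 + 2 * C\<^sup>2 * ?D / ?b k" using bp Cp by (simp add: field_simps power2_eq_square)
    finally have "?b k / 2 \<le> 2 * C\<^sup>2 * ?D / ?b k" by simp
    then have "(?b k)\<^sup>2 \<le> 4 * C\<^sup>2 * ?D" using bp by (simp add: field_simps power2_eq_square)
    also have "\<dots> \<le> K * ?D" using K D by (intro mult_right_mono) auto
    finally show ?thesis .
  qed
  have ub: "?b k \<le> K * 16 ^ k" for k
  proof -
    have "?b k \<le> C' * (4 ^ k)\<^sup>2" by (rule C'(2)) simp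
    also have "((4::real) ^ k)\<^sup>2 = 16 ^ k" by (simp add: power_mult[symmetric] mult.commute[of k] power_mult)
    also have "C' * 16 ^ k \<le> K * 16 ^ k" using K by (intro mult_right_mono) auto
    finally show ?thesis .
  qed
  show ?thesis
    by (rule quadratic_growth_recursion[of ?b K, OF energy_nonneg K(1) rec ub])
qed

lemma gradient_eq_0:
  assumes "0 \<le> x $ 3" "x $ 3 \<le> L"
  shows "pd i (U j) x = 0"
proof -
  \<comment> \<open>Large enough that \<open>cutoff ?R\<close> is 1 at \<open>x\<close>. The
    integrand is continuous and nonnegative with integral zero, so \<open>Q\<close> vanishes
    there.\<close>
  obtain m where m: "rad2 x + 1 < (4::real) ^ m" using real_arch_pow[of 4 "rad2 x + 1"] by auto
  let ?R = "(4::real) ^ m"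
  have R: "1 \<le> ?R" by simp
  have "?R * 1 \<le> ?R\<^sup>2" unfolding power2_eq_square using R by (intro mult_left_mono) auto
  then have r: "rad2 x \<le> ?R\<^sup>2" using m by linarith
  have b: "\<bar>x $ k\<bar> \<le> 2 * ?R" if "k = 1 \<or> k = 2" for k
  proof -
    have "\<bar>x $ k\<bar>\<^sup>2 \<le> ?R\<^sup>2" using that rad2_ge[of x] r by auto
    then have "\<bar>x $ k\<bar> \<le> ?R" by (rule power2_le_imp_le) simp
    then show ?thesis using R by linarith
  qed
  from b[of 1] b[of 2] have "- (2 * ?R) \<le> x $ 1" "x $ 1 \<le> 2 * ?R" "- (2 * ?R) \<le> x $ 2" "x $ 2 \<le> 2 * ?R"
    by (simp_all add: abs_le_iff minus_le_iff)
  then have box: "(x $ 1, x $ 2, x $ 3) \<in> cbox (- (2 * ?R), - (2 * ?R), 0) (2 * ?R, 2 * ?R, L)"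
    using assms by (simp add: cbox_Pair_eq)
  let ?f = "\<lambda>p. cutoff ?R (pt p) * Q (pt p)"
  have c: "continuous_on (cbox (- (2 * ?R), - (2 * ?R), 0) (2 * ?R, 2 * ?R, L)) ?f"
    by (rule continuous_on_comp_pt[of "\<lambda>x. cutoff ?R x * Q x"]) (intro cts continuous_on_id)+
  have 0: "integral (cbox (- (2 * ?R), - (2 * ?R), 0) (2 * ?R, 2 * ?R, L)) ?f = 0"
    using energy_eq_0[of m] by (simp add: energy_def slab_int_def)
  have "(0, 0, L / 2) \<in> box (- (2 * ?R), - (2 * ?R), 0) (2 * ?R, 2 * ?R, L)"
    using L_pos by (simp add: mem_box Basis_prod_def)
  then have ne: "box (- (2 * ?R), - (2 * ?R), 0) (2 * ?R, 2 * ?R, L) \<noteq> {}" by blast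
  have "0 \<le> ?f p" for p by (intro mult_nonneg_nonneg cutoff_bounds Q_nonneg)
  from integral_cbox_eq_0_iff[OF c ne this] 0 box have "?f (x $ 1, x $ 2, x $ 3) = 0" by blast
  then have "Q x = 0" using cutoff_eq_1[of ?R x] r by (simp add: pt_coords)
  then show ?thesis
    using exhaust_3[of i] exhaust_3[of j] 
    by (auto simp: Q_def sum_nonneg_eq_0_iff sum_nonneg)
qed

lemma constant_in_slab:
  assumes "0 \<le> x $ 3" "x $ 3 \<le> L" "0 \<le> y $ 3" "y $ 3 \<le> L"
  shows "U j x = U j y"
proof -
  let ?S = "{x :: real^3. 0 \<le> x $ 3 \<and> x $ 3 \<le> L}"
  have cv: "convex ?S"
    by (auto simp: convex_alt intro!: add_nonneg_nonneg mult_nonneg_nonneg convex_bound_le)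
  have "(U j has_derivative (\<lambda>h. 0)) (at x within ?S)" if "x \<in> ?S" for x
    using C1_has_derivative[OF C1_U, of j x] that by (simp add: gradient_eq_0 has_derivative_at_withinI)
  then obtain c where "\<And>x. x \<in> ?S \<Longrightarrow> U j x = c"
    using has_derivative_zero_constant[OF cv, of "U j"] by blast
  with assms show ?thesis by simp
qed

end

section \<open>Helical symmetry\<close>

lemma helS_nth: "helS k r x $ 1 = cos r * x $ 1 + sin r * x $ 2"
  "helS k r x $ 2 = - sin r * x $ 1 + cos r * x $ 2" "helS k r x $ 3 = x $ 3 + k * r"
  by (simp_all add: helS_def rotR_def)

lemma rotR_nth: "rotR r x $ 1 = cos r * x $ 1 + sin r * x $ 2"
  "rotR r x $ 2 = - sin r * x $ 1 + cos r * x $ 2" "rotR r x $ 3 = x $ 3"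
  by (simp_all add: rotR_def)

text \<open>The infinitesimal form of the symmetry: both sides are differentiated at angle 0 along
  the helix through \<open>x\<close>, whose velocity is \<open>d\<close>.\<close>

lemma helical_derivative:
  assumes h: "helically_symmetric_field k u" and c: "\<And>j. C1 (\<lambda>x. u x $ j)"
  shows "x $ 2 * pd 1 (\<lambda>x. u x $ 1) x - x $ 1 * pd 2 (\<lambda>x. u x $ 1) x + k * pd 3 (\<lambda>x. u x $ 1) x = u x $ 2"
    "x $ 2 * pd 1 (\<lambda>x. u x $ 2) x - x $ 1 * pd 2 (\<lambda>x. u x $ 2) x + k * pd 3 (\<lambda>x. u x $ 2) x = - u x $ 1"
proof -
  define d :: "real^3" where "d = vector [x $ 2, - x $ 1, k]"
  have 0: "helS k 0 x = x" by (simp add: vec_eq_iff forall_3 helS_nth)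
  have eq: "u (helS k r x) = rotR r (u x)" for r using h by (simp add: helically_symmetric_field_def)
  have "((\<lambda>r. helS k r x $ i) has_real_derivative d $ i) (at 0)" for i
    using exhaust_3[of i] by (auto simp: helS_nth d_def intro!: derivative_eq_intros)
  from C1_curve[OF c, of "\<lambda>r. helS k r x" "\<lambda>i. d $ i", OF this]
  have D: "((\<lambda>r. rotR r (u x) $ j) has_real_derivative
      x $ 2 * pd 1 (\<lambda>x. u x $ j) x - x $ 1 * pd 2 (\<lambda>x. u x $ j) x + k * pd 3 (\<lambda>x. u x $ j) x) (at 0)" for j
    by (simp add: 0 d_def eq)
  have "((\<lambda>r. rotR r (u x) $ 1) has_real_derivative u x $ 2) (at 0)"
    "((\<lambda>r. rotR r (u x) $ 2) has_real_derivative - u x $ 1) (at 0)"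
    unfolding rotR_nth by (auto intro!: derivative_eq_intros)
  with D show "x $ 2 * pd 1 (\<lambda>x. u x $ 1) x - x $ 1 * pd 2 (\<lambda>x. u x $ 1) x + k * pd 3 (\<lambda>x. u x $ 1) x = u x $ 2"
    "x $ 2 * pd 1 (\<lambda>x. u x $ 2) x - x $ 1 * pd 2 (\<lambda>x. u x $ 2) x + k * pd 3 (\<lambda>x. u x $ 2) x = - u x $ 1"
    by (blast intro: DERIV_unique)+
qed

text \<open>A full turn rotates by the identity and translates vertically by
  \<open>2 * pi * k\<close>; for negative pitch the translation is read backwards.\<close>

lemma helical_periodic:
  assumes "helically_symmetric_field k u"
  shows "zperiodic (2 * pi * \<bar>k\<bar>) u"
proof -
  have s: "helS k (2 * pi) x = x + (2 * pi * k) *\<^sub>R axis 3 1" for x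
    by (simp add: vec_eq_iff forall_3 helS_nth axis_nth axis_def)
  have "rotR (2 * pi) v = v" for v by (simp add: vec_eq_iff forall_3 rotR_nth)
  then have p: "u (x + (2 * pi * k) *\<^sub>R axis 3 1) = u x" for x
    using assms s by (metis helically_symmetric_field_def)
  show ?thesis
  proof (cases "0 \<le> k")
    case True
    then show ?thesis using p by (simp add: zperiodic_def)
  next
    case False
    then show ?thesis
      using p[of "_ + (2 * pi * \<bar>k\<bar>) *\<^sub>R axis 3 1"] by (simp add: zperiodic_def)
  qed
qed

text \<open>Along a horizontal ray from the axis, helical symmetry and incompressibility turn the radial
  derivative of the flux into a vertical derivative, which has zero mean by periodicity.\<close>

lemma (in periodic_flow) helical_mean_flux:
  assumes h1: "\<And>x. x $ 2 * pd 1 (U 1) x - x $ 1 * pd 2 (U 1) x + k * pd 3 (U 1) x = U 2 x"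
    and h2: "\<And>x. x $ 2 * pd 1 (U 2) x - x $ 1 * pd 2 (U 2) x + k * pd 3 (U 2) x = - U 1 x"
  shows "integral {0..L} (\<lambda>z. x * U 1 (pt (x, y, z)) + y * U 2 (pt (x, y, z))) = 0"
proof -
  define f where "f = (\<lambda>x. x $ 1 * U 1 x + x $ 2 * U 2 x)"
  have f: "C1 f" unfolding f_def by (intro C1_intros C1_U)
  have df: "pd 1 f x = U 1 x + x $ 1 * pd 1 (U 1) x + x $ 2 * pd 1 (U 2) x"
    "pd 2 f x = x $ 1 * pd 2 (U 1) x + U 2 x + x $ 2 * pd 2 (U 2) x" for x
    unfolding f_def by (simp_all add: pd_add pd_mult pd_coord C1_intros C1_U)
  \<comment> \<open>\<open>s\<close> runs along the ray from the axis, where the flux vanishes, to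
    the point \<open>(x, y)\<close> at \<open>s = 1\<close>.\<close>
  define g where "g = (\<lambda>s z. f (pt (s * x, s * y, z)))"
  define g' where "g' = (\<lambda>s z. x * pd 1 f (pt (s * x, s * y, z)) + y * pd 2 f (pt (s * x, s * y, z)))"
  have g': "((\<lambda>s. g s z) has_real_derivative g' s z) (at s)" for s z
  proof -
    define d :: "real^3" where "d = vector [x, y, 0]"
    have "((\<lambda>s. pt (s * x, s * y, z) $ i) has_real_derivative d $ i) (at s)" for i
      using exhaust_3[of i] by (auto simp: d_def intro!: derivative_eq_intros)
    from C1_curve[OF f, of "\<lambda>s. pt (s * x, s * y, z)" "\<lambda>i. d $ i", OF this]
    show ?thesis by (simp add: g_def g'_def d_def)
  qed
  have mean: "integral {0..L} (g' s) = 0" for s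
  proof -
    \<comment> \<open>A vertical primitive of \<open>g' s\<close>: the two terms with
      \<open>k\<close> come from the helical identities, which trade rotational derivatives for
      vertical ones, and the term with \<open>U 3\<close> from incompressibility.\<close>
    define w where "w = (\<lambda>p. k * y * U 1 p - k * x * U 2 p - s * (x\<^sup>2 + y\<^sup>2) * U 3 p)"
    have w: "C1 w" unfolding w_def by (intro C1_intros C1_U)
    have dw: "pd 3 w p = k * y * pd 3 (U 1) p - k * x * pd 3 (U 2) p - s * (x\<^sup>2 + y\<^sup>2) * pd 3 (U 3) p" for p
    proof -
      have "pd 3 (\<lambda>p. c * U i p) p = c * pd 3 (U i) p" for c i
        by (subst pd_mult[OF C1_const C1_U]) (simp add: pd_const)
      then show ?thesis unfolding w_def
        by (subst pd_diff pd_diff, (intro C1_intros C1_U)+)+ simp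
    qed
    have "g' s z = pd 3 w (pt (s * x, s * y, z))" for z
    proof -
      let ?p = "pt (s * x, s * y, z)"
      have a: "k * pd 3 (U 1) ?p = U 2 ?p - s * y * pd 1 (U 1) ?p + s * x * pd 2 (U 1) ?p"
        using h1[of ?p] by simp
      have b: "k * pd 3 (U 2) ?p = - U 1 ?p - s * y * pd 1 (U 2) ?p + s * x * pd 2 (U 2) ?p"
        using h2[of ?p] by simp
      have c: "pd 3 (U 3) ?p = - pd 1 (U 1) ?p - pd 2 (U 2) ?p"
        using div_free[of ?p] by (simp add: sum_3)
      have "pd 3 w ?p = y * (k * pd 3 (U 1) ?p) - x * (k * pd 3 (U 2) ?p) - s * (x\<^sup>2 + y\<^sup>2) * pd 3 (U 3) ?p"
        by (simp add: dw)
      also have "\<dots> = g' s z" unfolding a b c g'_def df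
        by (simp add: algebra_simps power2_eq_square)
      finally show ?thesis by simp
    qed
    then have "g' s = (\<lambda>z. pd 3 w (pt (s * x, s * y, z)))" by auto
    moreover have "integral {0..L} (\<lambda>z. pd 3 w (pt (s * x, s * y, z))) = 0"
    proof (rule integral_deriv_0[OF C1_pt_derivs(3)[OF w]])
      show "w (pt (s * x, s * y, 0)) = w (pt (s * x, s * y, L))"
        unfolding w_def using zperiodic_pt[OF periodic_U] by simp
    qed (use L_pos in simp)
    ultimately show ?thesis by simp
  qed
  have c: "continuous_on S (\<lambda>z. g s z)" "continuous_on T (\<lambda>(s, z). g' s z)" for s S T
  proof -
    show "continuous_on S (\<lambda>z. g s z)" unfolding g_def
      by (rule continuous_on_comp_pt[OF C1_cont[OF f]]) (intro continuous_intros)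
    have "continuous_on T (\<lambda>q. pd i f (pt (fst q * x, fst q * y, snd q)))" for i
      by (rule continuous_on_comp_pt[OF C1_pd_cont[OF f]]) (intro continuous_intros)
    then show "continuous_on T (\<lambda>(s, z). g' s z)" unfolding g'_def split_def
      by (intro continuous_intros)
  qed
  have "((\<lambda>s. integral (cbox 0 L) (g s)) has_real_derivative integral (cbox 0 L) (g' s)) (at s within UNIV)" for s
    using g' c by (intro leibniz_rule_field_derivative) (auto intro!: integrable_continuous_real)
  then have "((\<lambda>s. integral {0..L} (g s)) has_real_derivative 0) (at s)" for s
    by (simp add: mean cbox_interval)
  then have "integral {0..L} (g 1) = integral {0..L} (g 0)"
    using DERIV_isconst_all by blast
  moreover have "g 0 = (\<lambda>z. 0)" by (simp add: g_def f_def fun_eq_iff)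
  ultimately show ?thesis by (simp add: g_def f_def)
qed

text \<open>Half a turn lifts the origin by \<open>\<bar>k\<bar> * pi\<close>, still inside the
  slab, so the common value is invariant under rotation by pi, which negates horizontal components.
  The symmetry then carries the value to all heights.\<close>

lemma helical_constant_in_slab:
  assumes k: "k \<noteq> 0" and h: "helically_symmetric_field k u"
    and c: "\<And>x y. 0 \<le> x $ 3 \<Longrightarrow> x $ 3 \<le> 2 * pi * \<bar>k\<bar> \<Longrightarrow> 0 \<le> y $ 3 \<Longrightarrow> y $ 3 \<le> 2 * pi * \<bar>k\<bar> \<Longrightarrow> u x = u y"
  shows "\<exists>C. \<forall>x. u x = vector [0, 0, C]"
proof -
  define a where "a = u 0"
  have a: "u x = a" if "0 \<le> x $ 3" "x $ 3 \<le> 2 * pi * \<bar>k\<bar>" for x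
    unfolding a_def by (rule c) (use that in auto)
  have eq: "u (helS k r x) = rotR r (u x)" for r x using h by (simp add: helically_symmetric_field_def)
  have "\<bar>k\<bar> * pi \<le> 2 * pi * \<bar>k\<bar>" using pi_ge_zero by (simp add: mult_right_mono)
  then have "u (helS k (sgn k * pi) 0) = a"
    by (intro a) (simp_all add: helS_nth abs_sgn mult_ac)
  then have "a = rotR (sgn k * pi) a" using eq[of "sgn k * pi" 0] by (simp add: a_def)
  moreover have "cos (sgn k * pi) = - 1" "sin (sgn k * pi) = 0" using k by (auto simp: sgn_if)
  ultimately have "a $ 1 = - a $ 1" "a $ 2 = - a $ 2"
    using rotR_nth(1,2)[of "sgn k * pi" a] by simp_all
  then have a0: "a $ 1 = 0" "a $ 2 = 0" by simp_all
  have "u x = vector [0, 0, a $ 3]" for x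
  proof -
    \<comment> \<open>The angle at which the helical motion reaches the height of \<open>x\<close>;
      turning back by it brings \<open>x\<close> to height 0.\<close>
    let ?r = "x $ 3 / k"
    define y where "y = helS k (- ?r) x"
    have "helS k ?r y = x"
    proof -
      have "(cos ?r)\<^sup>2 + (sin ?r)\<^sup>2 = 1" by simp
      then have "cos ?r * cos ?r + sin ?r * sin ?r = 1" by (simp only: power2_eq_square)
      then have "(cos ?r * cos ?r + sin ?r * sin ?r) * v = v" for v by simp
      then have "cos ?r * (cos ?r * v) + sin ?r * (sin ?r * v) = v" for v
        by (simp only: distrib_right mult.assoc)
      then show ?thesis
        unfolding y_def vec_eq_iff forall_3 helS_nth using k by (simp add: algebra_simps)
    qed
    moreover have "u y = a" by (rule a) (use k in \<open>simp_all add: y_def helS_nth\<close>)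
    ultimately have "u x = rotR ?r a" using eq[of ?r y] by simp
    then show ?thesis by (simp add: vec_eq_iff forall_3 rotR_nth a0)
  qed
  then show ?thesis by blast
qed

theorem theorem1p1:
  fixes \<kappa> :: real and u :: "real^3 \<Rightarrow> real^3" and P :: "real^3 \<Rightarrow> real"
  assumes "\<kappa> \<noteq> 0"
    and "smooth u" and "smooth P"
    and "steady_NS u P"
    and "bounded (range u)"
    and "helically_symmetric_field \<kappa> u"
  shows "\<exists>C::real. \<forall>x. u x = vector [0, 0, C]"
proof -
  define U where "U = (\<lambda>i x. u x $ i)"
  define L where "L = 2 * pi * \<bar>\<kappa>\<bar>"
  obtain M where M: "\<And>x. norm (u x) \<le> M"
    using assms(5) by (auto simp: bounded_iff)
  interpret periodic_flow U P M L
  proof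
    show "smooth (U i)" for i unfolding U_def by (rule smooth_component[OF assms(2)])
    show "smooth P" by fact
    show "(\<Sum>i\<in>UNIV. pd i (pd i (U j)) x) = (\<Sum>i\<in>UNIV. U i x * pd i (U j) x) + pd j P x" for j x
      using assms(4) by (auto simp: steady_NS_def laplacian_def U_def algebra_simps)
    show "(\<Sum>i\<in>UNIV. pd i (U i) x) = 0" for x
      using assms(4) by (simp add: steady_NS_def divergence_def U_def)
    show "\<bar>U i x\<bar> \<le> M" for i x
      using component_le_norm_cart[of "u x" i] M[of x] by (simp add: U_def)
    show "zperiodic L (U i)" for i
      using helical_periodic[OF assms(6)] by (simp add: zperiodic_def U_def L_def)
    show "0 < L" using assms(1) by (simp add: L_def)
  qed
  have hd: "C1 (\<lambda>x. u x $ j)" for j using C1_U[of j] by (simp add: U_def)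
  interpret zero_flux_flow U P M L
  proof
    show "integral {0..L} (\<lambda>z. x * U 1 (pt (x, y, z)) + y * U 2 (pt (x, y, z))) = 0" for x y
      by (rule helical_mean_flux[of \<kappa>]) (use helical_derivative[OF assms(6) hd] in \<open>simp_all add: U_def\<close>)
  qed
  show ?thesis
  proof (rule helical_constant_in_slab[OF assms(1,6)])
    fix x y :: "real^3"
    assume "0 \<le> x $ 3" "x $ 3 \<le> 2 * pi * \<bar>\<kappa>\<bar>" "0 \<le> y $ 3" "y $ 3 \<le> 2 * pi * \<bar>\<kappa>\<bar>"
    then show "u x = u y" using constant_in_slab[of x y] by (simp add: vec_eq_iff U_def L_def)
  qed
qed

end
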